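(* Assume $\lozenge$ (Jensen's diamond principle). Then there exists an Efimov space $K$ whose function space $C_p(K)$ has a metrizable infinite-dimensional quotient.
   Context: An Efimov space is an infinite compact (Hausdorff) space that contains neither a non-trivial convergent sequence nor a topological copy of $\beta\mathbb{N}$, the Stone–Čech compactification of the discrete space $\mathbb{N}$. $C_p(K)$ is the space of continuous real-valued functions on $K$ with the topology of pointwise convergence. A quotient of a topological vector space $E$ is a space $E/Z$ with the quotient topology, where $Z$ is a closed linear subspace of $E$. $\lozenge$ is the statement that there is a sequence $(A_\alpha)_{\alpha<\omega_1}$ with $A_\alpha\subset\alpha$ such that for every $A\subset\omega_1$ the set $\{\alpha<\omega_1: A\cap\alpha=A_\alpha\}$ is stationary in $\omega_1$. *)

theory Defs
  imports "HOL-Analysis.Analysis"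
begin

section \<open>Jensen's diamond principle\<close>

text \<open>The first uncountable cardinal as a well-order on (a subset of) the type \<open>nat set\<close>.
  Its field is the set of all countable ordinals, and an ordinal \<open>\<alpha> < \<omega>\<^sub>1\<close>, viewed as the set of
  its predecessors, is \<open>underS omega1 \<alpha>\<close>.\<close>

definition omega1 :: "nat set rel" where
  "omega1 = cardSuc natLeq"

text \<open>Because \<open>\<gamma>\<close> is required to lie strictly above \<open>\<beta>\<close>, the closedness clause only speaks about
  nonzero limit ordinals \<open>\<delta>\<close> in which \<open>C\<close> is cofinal.\<close>

definition club_omega1 :: "nat set set \<Rightarrow> bool" where
  "club_omega1 C \<longleftrightarrow>
     C \<subseteq> Field omega1 \<and>
     (\<forall>\<alpha>\<in>Field omega1. \<exists>\<beta>\<in>C. (\<alpha>, \<beta>) \<in> omega1) \<and>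
     (\<forall>\<delta>\<in>Field omega1.
        underS omega1 \<delta> \<noteq> {} \<and>
        (\<forall>\<beta>\<in>underS omega1 \<delta>. \<exists>\<gamma>\<in>C \<inter> underS omega1 \<delta>. \<beta> \<in> underS omega1 \<gamma>)
        \<longrightarrow> \<delta> \<in> C)"

definition stationary_omega1 :: "nat set set \<Rightarrow> bool" where
  "stationary_omega1 S \<longleftrightarrow> S \<subseteq> Field omega1 \<and> (\<forall>C. club_omega1 C \<longrightarrow> S \<inter> C \<noteq> {})"

definition diamond :: bool where
  "diamond \<longleftrightarrow>
     (\<exists>A :: nat set \<Rightarrow> nat set set.
        (\<forall>\<alpha>\<in>Field omega1. A \<alpha> \<subseteq> underS omega1 \<alpha>) \<and>
        (\<forall>X. X \<subseteq> Field omega1 \<longrightarrow>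
           stationary_omega1 {\<alpha> \<in> Field omega1. X \<inter> underS omega1 \<alpha> = A \<alpha>}))"


section \<open>Efimov spaces\<close>

text \<open>Tychonoff's construction: the closure of the image of \<open>X\<close> under the evaluation map into
  the cube \<open>[0,1]\<^bsup>C(X,[0,1])\<^esup>\<close>.\<close>

definition unit_functions :: "'a topology \<Rightarrow> ('a \<Rightarrow> real) set" where
  "unit_functions X =
     {f \<in> extensional (topspace X). continuous_map X (top_of_set {0..1}) f}"

definition evaluation :: "'a topology \<Rightarrow> 'a \<Rightarrow> ('a \<Rightarrow> real) \<Rightarrow> real" where
  "evaluation X x = (\<lambda>f\<in>unit_functions X. f x)"

definition stone_cech :: "'a topology \<Rightarrow> (('a \<Rightarrow> real) \<Rightarrow> real) topology" where
  "stone_cech X =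
     (let P = product_topology (\<lambda>_. top_of_set {0..1}) (unit_functions X)
      in subtopology P (P closure_of (evaluation X ` topspace X)))"

abbreviation beta_nat :: "((nat \<Rightarrow> real) \<Rightarrow> real) topology" where
  "beta_nat \<equiv> stone_cech (discrete_topology UNIV)"

definition has_nontrivial_convergent_sequence :: "'a topology \<Rightarrow> bool" where
  "has_nontrivial_convergent_sequence X \<longleftrightarrow>
     (\<exists>x l. range x \<subseteq> topspace X \<and> limitin X x l sequentially \<and>
        \<not> (\<exists>c. \<forall>\<^sub>F n in sequentially. x n = c))"

definition efimov_space :: "'a topology \<Rightarrow> bool" where
  "efimov_space X \<longleftrightarrow>
     compact_space X \<and> Hausdorff_space X \<and> infinite (topspace X) \<and>
     \<not> has_nontrivial_convergent_sequence X \<and>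
     \<not> (\<exists>e. embedding_map beta_nat X e)"


section \<open>Real topological vector spaces with explicit carrier\<close>

text \<open>The carrier is the underlying set of the topology.\<close>

record 'v tvs =
  top_of :: "'v topology"
  vzero :: 'v
  vadd :: "'v \<Rightarrow> 'v \<Rightarrow> 'v"
  vscale :: "real \<Rightarrow> 'v \<Rightarrow> 'v"

abbreviation vcarrier :: "'v tvs \<Rightarrow> 'v set" where
  "vcarrier E \<equiv> topspace (top_of E)"

definition linear_subspace :: "'v tvs \<Rightarrow> 'v set \<Rightarrow> bool" where
  "linear_subspace E W \<longleftrightarrow>
     W \<subseteq> vcarrier E \<and> vzero E \<in> W \<and>
     (\<forall>u\<in>W. \<forall>v\<in>W. vadd E u v \<in> W) \<and>
     (\<forall>c. \<forall>u\<in>W. vscale E c u \<in> W)"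

definition linear_span :: "'v tvs \<Rightarrow> 'v set \<Rightarrow> 'v set" where
  "linear_span E B = linear_subspace E hull B"

definition infinite_dimensional :: "'v tvs \<Rightarrow> bool" where
  "infinite_dimensional E \<longleftrightarrow>
     \<not> (\<exists>B. finite B \<and> B \<subseteq> vcarrier E \<and> linear_span E B = vcarrier E)"

definition coset :: "'v tvs \<Rightarrow> 'v set \<Rightarrow> 'v \<Rightarrow> 'v set" where
  "coset E Z u = vadd E u ` Z"

definition coset_topology :: "'v tvs \<Rightarrow> 'v set \<Rightarrow> 'v set topology" where
  "coset_topology E Z =
     topology (\<lambda>U. U \<subseteq> coset E Z ` vcarrier E \<and>
                   openin (top_of E) {u \<in> vcarrier E. coset E Z u \<in> U})"

lemma openin_coset_topology:
  "openin (coset_topology E Z) U \<longleftrightarrow>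
     U \<subseteq> coset E Z ` vcarrier E \<and> openin (top_of E) {u \<in> vcarrier E. coset E Z u \<in> U}"
proof -
  let ?L = "\<lambda>U. U \<subseteq> coset E Z ` vcarrier E \<and>
                openin (top_of E) {u \<in> vcarrier E. coset E Z u \<in> U}"
  have "istopology ?L"
    unfolding istopology_def
  proof (intro conjI allI impI)
    fix S T assume "?L S" "?L T"
    then have "openin (top_of E)
        ({u \<in> vcarrier E. coset E Z u \<in> S} \<inter> {u \<in> vcarrier E. coset E Z u \<in> T})"
      by blast
    moreover have "{u \<in> vcarrier E. coset E Z u \<in> S} \<inter> {u \<in> vcarrier E. coset E Z u \<in> T}
        = {u \<in> vcarrier E. coset E Z u \<in> S \<inter> T}"
      by blast
    ultimately show "openin (top_of E) {u \<in> vcarrier E. coset E Z u \<in> S \<inter> T}"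
      by simp
    show "S \<inter> T \<subseteq> coset E Z ` vcarrier E"
      using \<open>?L S\<close> by blast
  next
    fix \<K> assume K: "\<forall>S\<in>\<K>. ?L S"
    then have "openin (top_of E) (\<Union>S\<in>\<K>. {u \<in> vcarrier E. coset E Z u \<in> S})"
      by blast
    moreover have "(\<Union>S\<in>\<K>. {u \<in> vcarrier E. coset E Z u \<in> S})
        = {u \<in> vcarrier E. coset E Z u \<in> \<Union>\<K>}"
      by blast
    ultimately show "openin (top_of E) {u \<in> vcarrier E. coset E Z u \<in> \<Union>\<K>}"
      by simp
    show "\<Union>\<K> \<subseteq> coset E Z ` vcarrier E"
      using K by blast
  qed
  then show ?thesis
    by (simp add: coset_topology_def)
qed

lemma quotient_map_coset: "quotient_map (top_of E) (coset_topology E Z) (coset E Z)"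
proof -
  have "{u \<in> vcarrier E. coset E Z u \<in> coset E Z ` vcarrier E} = vcarrier E"
    by blast
  then have "openin (coset_topology E Z) (coset E Z ` vcarrier E)"
    by (simp add: openin_coset_topology)
  then have "topspace (coset_topology E Z) = coset E Z ` vcarrier E"
    by (metis openin_coset_topology openin_subset openin_topspace subset_antisym)
  then show ?thesis
    by (auto simp: quotient_map_def openin_coset_topology)
qed

text \<open>The scalar multiple of a coset is taken as \<open>c A + Z\<close> rather than \<open>c A\<close>, so that it is again
  a coset for \<open>c = 0\<close>.\<close>

definition quotient_tvs :: "'v tvs \<Rightarrow> 'v set \<Rightarrow> 'v set tvs" where
  "quotient_tvs E Z =
     \<lparr> top_of = coset_topology E Z,
       vzero = Z,
       vadd = (\<lambda>A B. {vadd E a b | a b. a \<in> A \<and> b \<in> B}),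
       vscale = (\<lambda>c A. {vadd E (vscale E c a) z | a z. a \<in> A \<and> z \<in> Z}) \<rparr>"


section \<open>Spaces of continuous functions with the pointwise topology\<close>

text \<open>Functions on \<open>K\<close> are represented by extensional ones (constantly \<open>undefined\<close> outside the
  underlying set of \<open>K\<close>), in accordance with \<open>product_topology\<close>.\<close>

definition Cp :: "'a topology \<Rightarrow> ('a \<Rightarrow> real) tvs" where
  "Cp K =
     \<lparr> top_of = subtopology (product_topology (\<lambda>_. euclideanreal) (topspace K))
                  {f. continuous_map K euclideanreal f},
       vzero = (\<lambda>x\<in>topspace K. 0),
       vadd = (\<lambda>f g. \<lambda>x\<in>topspace K. f x + g x),
       vscale = (\<lambda>c f. \<lambda>x\<in>topspace K. c * f x) \<rparr>"

end

theory Submission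
  imports Defs "HOL-Library.Countable_Set_Type"
begin

text \<open>A Fedorchuk-style space \<open>L \<subseteq> 2\<^bsup>\<omega>\<^sub>1\<^esup>\<close> is built by transfinite recursion: at stage \<open>\<alpha>\<close> a single point
  \<open>z\<^sub>\<alpha>\<close> of the space \<open>X\<^sub>\<alpha> \<subseteq> 2\<^sup>\<alpha>\<close> constructed so far is split in two, while at every other point the
  coordinate \<open>\<alpha>\<close> is a continuous function of the earlier ones. If \<open>\<diamondsuit>\<close> guesses an injective sequence
  in \<open>X\<^sub>\<alpha>\<close>, then \<open>z\<^sub>\<alpha>\<close> is chosen as an accumulation point of the sequence along two disjoint sets of
  indices, and this and all later splittings are arranged so that every point over \<open>z\<^sub>\<alpha>\<close> remains
  an accumulation point along both sets, for every lifting of the sequence. Hence every injective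
  sequence in \<open>L\<close> has two disjoint subsequences with two distinct common accumulation points, which
  excludes convergent sequences as well as copies of \<open>\<beta>\<nat>\<close>.

  For the quotient, attach to \<open>L\<close> isolated points \<open>D\<^sub>n\<close> that approach \<open>L\<close> along an injective sequence
  \<open>d\<^sub>n \<in> L\<close>, that is, let \<open>K = L \<times> {0} \<union> {(d\<^sub>n, 1/(n+1))}\<close>. This keeps the accumulation property. The
  projection \<open>\<rho>\<close> of \<open>K\<close> to \<open>L\<close> is a retraction, and \<open>f \<mapsto> f - f \<circ> \<rho>\<close> exhibits the quotient of \<open>C\<^sub>p(K)\<close>
  by the functions with \<open>f = f \<circ> \<rho>\<close> as a space of functions on the countable set of the \<open>D\<^sub>n\<close>.\<close>

section \<open>Diamond and sequences in the Cantor cube\<close>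

abbreviation omega1_less :: "nat set \<Rightarrow> nat set \<Rightarrow> bool" where
  "omega1_less a b \<equiv> a \<in> underS omega1 b"

context
  includes cardinal_syntax
begin

section \<open>Order and cardinality of the countable ordinals\<close>

lemma Card_order_omega1: "Card_order omega1"
  by (simp add: omega1_def cardSuc_Card_order natLeq_Card_order)

lemma Well_order_omega1: "Well_order omega1"
  using Card_order_omega1 by (simp add: card_order_on_well_order_on)

lemma wf_omega1_less: "wf {(a, b). omega1_less a b}"
proof -
  have "{(a, b). omega1_less a b} = omega1 - Id" by (auto simp: underS_def)
  then show ?thesis using Well_order_omega1 by (simp add: well_order_on_def)
qed

lemma omega1_less_trans: "omega1_less a b \<Longrightarrow> omega1_less b c \<Longrightarrow> omega1_less a c"
proof -
  interpret wo_rel omega1 using Well_order_omega1 by (simp add: wo_rel_def)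
  show "omega1_less a b \<Longrightarrow> omega1_less b c \<Longrightarrow> omega1_less a c"
    using TRANS ANTISYM unfolding underS_def trans_def antisym_def mem_Collect_eq by metis
qed

lemma omega1_less_total:
  "a \<in> Field omega1 \<Longrightarrow> b \<in> Field omega1 \<Longrightarrow> omega1_less a b \<or> a = b \<or> omega1_less b a"
proof -
  interpret wo_rel omega1 using Well_order_omega1 by (simp add: wo_rel_def)
  show "a \<in> Field omega1 \<Longrightarrow> b \<in> Field omega1 \<Longrightarrow> ?thesis"
    using TOTALS by (auto simp: underS_def)
qed

lemma omega1_less_Field: "omega1_less a b \<Longrightarrow> a \<in> Field omega1 \<and> b \<in> Field omega1"
  by (auto simp: underS_def Field_def)

lemma countable_underS_omega1: "countable (underS omega1 a)"
proof (cases "a \<in> Field omega1")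
  case True
  then have "|underS omega1 a| <o cardSuc natLeq"
    using card_of_underS[OF Card_order_omega1] by (simp add: omega1_def)
  then have "|underS omega1 a| \<le>o natLeq"
    by (simp add: cardSuc_ordLeq_ordLess card_of_Card_order natLeq_Card_order)
  then show ?thesis by (simp add: countable_card_le_natLeq)
next
  case False
  then have "underS omega1 a = {}" by (auto simp: underS_def Field_def)
  then show ?thesis by simp
qed

lemma uncountable_omega1: "uncountable (Field omega1)"
proof
  assume "countable (Field omega1)"
  then have "|Field omega1| \<le>o natLeq" by (simp add: countable_card_le_natLeq)
  then have "omega1 \<le>o natLeq"
    using card_of_Field_ordIso[OF Card_order_omega1] ordIso_ordLeq_trans ordIso_symmetric by blast
  moreover have "natLeq <o omega1"
    by (simp add: omega1_def cardSuc_greater natLeq_Card_order)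
  ultimately show False using not_ordLess_ordLeq by blast
qed

text \<open>If \<open>B\<close> had no strict upper bound, the field would be covered by
  \<open>B\<close> and the countably many countable segments below its elements.\<close>

lemma countable_bounded_omega1:
  assumes "countable B" "B \<subseteq> Field omega1"
  shows "\<exists>a\<in>Field omega1. \<forall>b\<in>B. omega1_less b a"
proof (rule ccontr)
  assume contra: "\<not> ?thesis"
  have "Field omega1 \<subseteq> B \<union> (\<Union>b\<in>B. underS omega1 b)"
  proof
    fix a assume a: "a \<in> Field omega1"
    then obtain b where b: "b \<in> B" "\<not> omega1_less b a" using contra by blast
    then have "a = b \<or> omega1_less a b" using omega1_less_total[OF a, of b] assms(2) by blast
    then show "a \<in> B \<union> (\<Union>b\<in>B. underS omega1 b)" using b(1) by blast
  qed
  moreover have "countable (B \<union> (\<Union>b\<in>B. underS omega1 b))"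
    using assms(1) countable_underS_omega1 by simp
  ultimately show False using uncountable_omega1 countable_subset by blast
qed

text \<open>For unboundedness, start above \<open>a0\<close> and \<open>a\<close> and pass
  repeatedly to a bound for all values produced so far; the least upper bound of these countably
  many steps is closed under every \<open>h n\<close>.\<close>

lemma club_closure_points:
  fixes h :: "nat \<Rightarrow> nat set \<Rightarrow> nat set"
  assumes a0: "a0 \<in> Field omega1" and h: "\<And>n b. b \<in> Field omega1 \<Longrightarrow> h n b \<in> Field omega1"
  shows "club_omega1 {a. omega1_less a0 a \<and> (\<forall>n b. omega1_less b a \<longrightarrow> omega1_less (h n b) a)}"
    (is "club_omega1 ?C")
  unfolding club_omega1_def
proof (intro conjI ballI impI)
  show "?C \<subseteq> Field omega1" using omega1_less_Field by blast
next
  fix a assume a: "a \<in> Field omega1"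
  have "\<exists>y. omega1_less x y \<and> (\<forall>n b. omega1_less b x \<longrightarrow> omega1_less (h n b) y)"
    if "x \<in> Field omega1" for x
  proof -
    let ?B = "insert x ((\<lambda>(n, b). h n b) ` (UNIV \<times> underS omega1 x))"
    have "countable ?B" by (intro countable_insert countable_image countable_SIGMA)
      (simp_all add: countable_underS_omega1)
    moreover have "?B \<subseteq> Field omega1" using that h omega1_less_Field by auto
    ultimately have "\<exists>a\<in>Field omega1. \<forall>b\<in>?B. omega1_less b a" by (rule countable_bounded_omega1)
    then show ?thesis by auto
  qed
  then obtain nxt where nxt: "\<And>x. x \<in> Field omega1 \<Longrightarrow> omega1_less x (nxt x)"
    "\<And>x n b. x \<in> Field omega1 \<Longrightarrow> omega1_less b x \<Longrightarrow> omega1_less (h n b) (nxt x)" by metis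
  have "countable {a0, a}" "{a0, a} \<subseteq> Field omega1" using a a0 by auto
  then have "\<exists>x\<in>Field omega1. \<forall>b\<in>{a0, a}. omega1_less b x" by (rule countable_bounded_omega1)
  then obtain x0 where x0: "x0 \<in> Field omega1" "omega1_less a0 x0" "omega1_less a x0" by auto
  define f where "f k = (nxt ^^ k) x0" for k
  have f: "f k \<in> Field omega1" "f (Suc k) = nxt (f k)" for k
  proof -
    show "f (Suc k) = nxt (f k)" by (simp add: f_def)
    show "f k \<in> Field omega1"
      by (induction k) (use x0 nxt(1) omega1_less_Field in \<open>auto simp: f_def\<close>)
  qed
  have "countable (range f)" "range f \<subseteq> Field omega1" using f by auto
  then have "\<exists>y\<in>Field omega1. \<forall>b\<in>range f. omega1_less b y" by (rule countable_bounded_omega1)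
  then obtain y where "y \<in> {y. \<forall>k. omega1_less (f k) y}" by auto
  from wfE_min[OF wf_omega1_less this] obtain d where
    d0: "d \<in> {y. \<forall>k. omega1_less (f k) y}" and
    d1: "\<And>b. (b, d) \<in> {(a, b). omega1_less a b} \<Longrightarrow> b \<notin> {y. \<forall>k. omega1_less (f k) y}"
    by blast
  have d: "\<forall>k. omega1_less (f k) d" "\<And>b. omega1_less b d \<Longrightarrow> \<not> (\<forall>k. omega1_less (f k) b)"
    using d0 d1 by simp_all
  have "omega1_less (h n b) d" if b: "omega1_less b d" for n b
  proof -
    obtain k where "\<not> omega1_less (f k) b" using d(2)[OF b] by blast
    then have "b = f k \<or> omega1_less b (f k)"
      using omega1_less_total[of b "f k"] f(1) omega1_less_Field[OF b] by blast
    then have "omega1_less b (f (Suc k))"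
      using nxt(1)[OF f(1)[of k]] f(2)[of k] omega1_less_trans by auto
    then have "omega1_less (h n b) (f (Suc (Suc k)))"
      using nxt(2)[OF f(1)[of "Suc k"], of b n] f(2)[of "Suc k"] by simp
    then show ?thesis using d(1) omega1_less_trans by blast
  qed
  moreover have "omega1_less x0 d" using d(1)[rule_format, of 0] by (simp add: f_def)
  ultimately have "d \<in> ?C" "omega1_less a d"
    using x0 omega1_less_trans by blast+
  then show "\<exists>b\<in>?C. (a, b) \<in> omega1" by (auto simp: underS_def)
next
  fix d assume "d \<in> Field omega1" and d: "underS omega1 d \<noteq> {} \<and>
    (\<forall>b\<in>underS omega1 d. \<exists>c\<in>?C \<inter> underS omega1 d. b \<in> underS omega1 c)"
  have lim: "\<exists>c. c \<in> ?C \<and> omega1_less c d \<and> omega1_less b c" if "omega1_less b d" for b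
    using d that by blast
  obtain b where "omega1_less b d" using d by blast
  then have "omega1_less a0 d" using lim omega1_less_trans by blast
  moreover have "omega1_less (h n b) d" if "omega1_less b d" for n b
    using lim[OF that] omega1_less_trans by blast
  ultimately show "d \<in> ?C" by blast
qed

text \<open>A sequence of points of the cube is coded by one subset of \<open>Field omega1\<close>
  through a bijection \<open>h\<close> with \<open>nat \<times> Field omega1\<close>. At a stage
  closed under all maps \<open>b \<mapsto> h (n, b)\<close>, the set guessed there decodes to the
  restrictions of all terms.\<close>

lemma diamond_guesses_sequences:
  assumes diamond
  obtains t :: "nat set \<Rightarrow> nat \<Rightarrow> nat set \<Rightarrow> bool" where
    "\<And>a0 s. a0 \<in> Field omega1 \<Longrightarrow>
       \<exists>a. omega1_less a0 a \<and> (\<forall>n c. omega1_less c a \<longrightarrow> t a n c = s n c)"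
proof -
  obtain A where A: "\<And>X. X \<subseteq> Field omega1 \<Longrightarrow>
      stationary_omega1 {a \<in> Field omega1. X \<inter> underS omega1 a = A a}"
    using assms unfolding diamond_def by blast
  have inf: "infinite (Field omega1)"
    using uncountable_omega1 countable_finite by blast
  have "|UNIV::nat set| \<le>o |Field omega1|"
    using inf infinite_iff_card_of_nat by blast
  then have "|(UNIV::nat set) \<times> Field omega1| =o |Field omega1|"
    using card_of_Times_infinite[OF inf, of "UNIV::nat set"] by blast
  then obtain h where "bij_betw h ((UNIV::nat set) \<times> Field omega1) (Field omega1)"
    using card_of_ordIso by blast
  then have h: "inj_on h (UNIV \<times> Field omega1)" "\<And>n b. b \<in> Field omega1 \<Longrightarrow> h (n, b) \<in> Field omega1"
    by (auto simp: bij_betw_def)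
  define t where "t a n c \<longleftrightarrow> h (n, c) \<in> A a" for a n c
  show thesis
  proof (rule that[of t])
    fix a0 and s :: "nat \<Rightarrow> nat set \<Rightarrow> bool" assume a0: "a0 \<in> Field omega1"
    define X where "X = {h (n, b) | n b. b \<in> Field omega1 \<and> s n b}"
    have "X \<subseteq> Field omega1" using h(2) by (auto simp: X_def)
    from A[OF this] obtain a where a: "a \<in> Field omega1" "X \<inter> underS omega1 a = A a"
      "omega1_less a0 a" "\<And>n b. omega1_less b a \<Longrightarrow> omega1_less (h (n, b)) a"
      using club_closure_points[OF a0, of "\<lambda>n b. h (n, b)"] h(2)
      unfolding stationary_omega1_def by blast
    have "t a n c = s n c" if c: "omega1_less c a" for n c
    proof -
      have cF: "c \<in> Field omega1" using omega1_less_Field[OF c] by blast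
      have "h (n, c) \<in> A a \<longleftrightarrow> h (n, c) \<in> X" using a(2) a(4)[OF c] by blast
      also have "\<dots> \<longleftrightarrow> s n c"
      proof
        assume "h (n, c) \<in> X"
        then obtain m b where "h (n, c) = h (m, b)" "b \<in> Field omega1" "s m b"
          unfolding X_def by blast
        then show "s n c" using inj_onD[OF h(1), of "(n, c)" "(m, b)"] cF by simp
      qed (use cF in \<open>auto simp: X_def\<close>)
      finally show ?thesis by (simp add: t_def)
    qed
    then show "\<exists>a. omega1_less a0 a \<and> (\<forall>n c. omega1_less c a \<longrightarrow> t a n c = s n c)"
      using a(3) by blast
  qed
qed

end

section \<open>The inverse limit construction\<close>

text \<open>The naturals are cut into consecutive blocks, each containing a window from
  \<open>k\<close> to \<open>l\<close> that \<open>F\<close> supplies for one \<open>p\<close>, and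
  \<open>e\<close> is constant on each block. Every pair of a \<open>p\<close> and a value
  \<open>b\<close> is served by infinitely many blocks.\<close>

lemma ex_prescribed_on_blocks:
  fixes F :: "'p \<Rightarrow> nat \<Rightarrow> nat \<Rightarrow> bool"
  assumes "countable Q" and F: "\<And>p k. p \<in> Q \<Longrightarrow> \<exists>l. F p k l"
  shows "\<exists>e::nat \<Rightarrow> bool. \<forall>p\<in>Q. \<forall>k b. \<exists>k'\<ge>k. \<exists>l. F p k' l \<and> (\<forall>j. k' \<le> j \<and> j < l \<longrightarrow> e j = b)"
proof (cases "Q = {}")
  case False
  \<comment> \<open>The factor \<open>nat\<close> makes the enumeration \<open>h\<close> return to
    every pair of \<open>p\<close> and \<open>b\<close> infinitely often.\<close>
  define R :: "('p \<times> bool \<times> nat) set" where "R = Q \<times> UNIV"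
  define h where "h = from_nat_into R"
  have R: "countable R" "R \<noteq> {}"
    using assms(1) False by (auto simp: R_def)
  have hQ: "fst (h i) \<in> Q" for i
    using from_nat_into[OF R(2), of i] by (auto simp: h_def R_def)
  obtain L where L: "\<And>p k. p \<in> Q \<Longrightarrow> F p k (L p k)"
    using F by metis
  \<comment> \<open>Block \<open>i\<close> runs from \<open>K i\<close> to \<open>K (Suc i)\<close>;
    the maximum makes room for the window of \<open>h i\<close> and keeps \<open>K\<close> strictly
    increasing.\<close>
  define K where "K = rec_nat 0 (\<lambda>i k. max (Suc k) (L (fst (h i)) k))"
  have K: "K (Suc i) = max (Suc (K i)) (L (fst (h i)) (K i))" for i
    by (simp add: K_def)
  have sm: "strict_mono K"
    by (rule strict_monoI_Suc) (simp add: K less_max_iff_disj)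
  define e where "e j = fst (snd (h (LEAST i. j < K (Suc i))))" for j
  have e: "e j = fst (snd (h i))" if "K i \<le> j" "j < K (Suc i)" for i j
  proof -
    have "(LEAST i. j < K (Suc i)) = i"
    proof (rule Least_equality)
      fix i' assume "j < K (Suc i')"
      then have "K i < K (Suc i')" using that by simp
      then show "i \<le> i'" using sm by (simp add: strict_mono_less)
    qed (use that in simp)
    then show ?thesis by (simp add: e_def)
  qed
  have "\<exists>k'\<ge>k. \<exists>l. F p k' l \<and> (\<forall>j. k' \<le> j \<and> j < l \<longrightarrow> e j = b)" if p: "p \<in> Q" for p k b
  proof -
    have "infinite {i. fst (h i) = p \<and> fst (snd (h i)) = b}"
    proof
      assume fin: "finite {i. fst (h i) = p \<and> fst (snd (h i)) = b}"
      have "range (\<lambda>n. (p, b, n)) \<subseteq> h ` {i. fst (h i) = p \<and> fst (snd (h i)) = b}"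
      proof
        fix w assume "w \<in> range (\<lambda>n::nat. (p, b, n))"
        moreover from this have "w \<in> R" using p by (auto simp: R_def)
        then obtain i where "h i = w"
          using from_nat_into_surj[OF R(1), of w] unfolding h_def by blast
        ultimately show "w \<in> h ` {i. fst (h i) = p \<and> fst (snd (h i)) = b}" by auto
      qed
      then have "finite (range (\<lambda>n::nat. (p, b, n)))"
        using fin finite_surj by blast
      then show False
        using finite_imageD[of "\<lambda>n::nat. (p, b, n)" UNIV] by (simp add: inj_on_def)
    qed
    then obtain i where i: "i \<ge> k" "fst (h i) = p" "fst (snd (h i)) = b"
      unfolding infinite_nat_iff_unbounded_le by blast
    have "K i \<ge> k"
      using i(1) seq_suble[OF sm, of i] by simp
    moreover have "F p (K i) (L p (K i))" using L p by blast
    moreover have "e j = b" if "K i \<le> j" "j < L p (K i)" for j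
      using e[of i j] that i K[of i] by simp
    ultimately show ?thesis by blast
  qed
  then show ?thesis by blast
qed auto

text \<open>The properties of \<open>omega1\<close> and of the guesses on which the construction
  rests; \<open>t a n c\<close> is coordinate \<open>c\<close> of term \<open>n\<close> of the
  sequence guessed at \<open>a\<close>.\<close>

locale guessing =
  fixes lt :: "'i \<Rightarrow> 'i \<Rightarrow> bool" (infix "\<sqsubset>" 50)
    and I :: "'i set"
    and t :: "'i \<Rightarrow> nat \<Rightarrow> 'i \<Rightarrow> bool"
  assumes wf: "wf {(a, b). a \<sqsubset> b}"
    and trans: "a \<sqsubset> b \<Longrightarrow> b \<sqsubset> c \<Longrightarrow> a \<sqsubset> c"
    and total: "a \<in> I \<Longrightarrow> b \<in> I \<Longrightarrow> a \<sqsubset> b \<or> a = b \<or> b \<sqsubset> a"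
    and field: "a \<sqsubset> b \<Longrightarrow> a \<in> I \<and> b \<in> I"
    and countable_below: "countable {b. b \<sqsubset> a}"
    and bounded: "countable B \<Longrightarrow> B \<subseteq> I \<Longrightarrow> \<exists>a\<in>I. \<forall>b\<in>B. b \<sqsubset> a"
    and guess: "a0 \<in> I \<Longrightarrow> \<exists>a. a0 \<sqsubset> a \<and> (\<forall>n c. c \<sqsubset> a \<longrightarrow> t a n c = s n c)"
begin

section \<open>Restrictions to initial segments and first differences\<close>

lemma irrefl: "\<not> a \<sqsubset> a"
  using wf_irrefl[OF wf] by blast

lemma lt_induct [case_names less]:
  assumes "\<And>x. (\<And>y. y \<sqsubset> x \<Longrightarrow> P y) \<Longrightarrow> P x"
  shows "P a"
  using wf by (rule wf_induct) (use assms in auto)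

text \<open>A point of \<open>2\<^sup>a\<close> is represented by any function on the whole index
  type with the right values below \<open>a\<close>; \<open>agree a\<close> is equality of the
  represented points.\<close>

definition agree :: "'i \<Rightarrow> ('i \<Rightarrow> bool) \<Rightarrow> ('i \<Rightarrow> bool) \<Rightarrow> bool" where
  "agree a x y \<longleftrightarrow> (\<forall>c. c \<sqsubset> a \<longrightarrow> x c = y c)"

definition idx :: "'i \<Rightarrow> 'i \<Rightarrow> nat" where
  "idx a c = to_nat_on {b. b \<sqsubset> a} c"

text \<open>For fixed \<open>y\<close>, the values of \<open>first_diff a x y\<close> partition the
  points of \<open>2\<^sup>a\<close> other than \<open>y\<close> into clopen pieces that shrink to
  \<open>y\<close> as the value grows. The value is meaningful only if \<open>x\<close> and
  \<open>y\<close> do not agree below \<open>a\<close>.\<close>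

definition first_diff :: "'i \<Rightarrow> ('i \<Rightarrow> bool) \<Rightarrow> ('i \<Rightarrow> bool) \<Rightarrow> nat" where
  "first_diff a x y = (LEAST k. \<exists>c. c \<sqsubset> a \<and> idx a c = k \<and> x c \<noteq> y c)"

lemma agree_mono: "agree a x y \<Longrightarrow> b \<sqsubset> a \<Longrightarrow> agree b x y"
  using trans by (auto simp: agree_def)

lemma finite_idx_le: "finite {c. c \<sqsubset> a \<and> idx a c \<le> k}"
proof (rule finite_imageD)
  show "finite (idx a ` {c. c \<sqsubset> a \<and> idx a c \<le> k})"
    by (rule finite_subset[of _ "{..k}"]) auto
  show "inj_on (idx a) {c. c \<sqsubset> a \<and> idx a c \<le> k}"
    using inj_on_to_nat_on[OF countable_below[of a]] by (auto simp: inj_on_def idx_def)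
qed

lemma first_diff_le: "c \<sqsubset> a \<Longrightarrow> x c \<noteq> y c \<Longrightarrow> first_diff a x y \<le> idx a c"
  unfolding first_diff_def by (rule Least_le) auto

lemma first_diff_witness:
  assumes "\<not> agree a x y"
  shows "\<exists>c. c \<sqsubset> a \<and> idx a c = first_diff a x y \<and> x c \<noteq> y c"
proof -
  have "\<exists>k c. c \<sqsubset> a \<and> idx a c = k \<and> x c \<noteq> y c"
    using assms by (auto simp: agree_def)
  then show ?thesis
    unfolding first_diff_def by (rule LeastI_ex)
qed

lemma first_diff_ge:
  assumes "\<not> agree a x y" "\<And>c. c \<sqsubset> a \<Longrightarrow> idx a c < k \<Longrightarrow> x c = y c"
  shows "k \<le> first_diff a x y"
  using first_diff_witness[OF assms(1)] assms(2) by (metis not_le)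

text \<open>The first difference with \<open>z\<close> is decided by finitely many coordinates of
  \<open>x\<close>. This makes the new coordinate at a stage continuous off the split point.\<close>

lemma first_diff_cong:
  assumes "\<not> agree a x z" and *: "\<And>c. c \<sqsubset> a \<Longrightarrow> idx a c \<le> first_diff a x z \<Longrightarrow> y c = x c"
  shows "\<not> agree a y z" "first_diff a y z = first_diff a x z"
proof -
  obtain c where c: "c \<sqsubset> a" "idx a c = first_diff a x z" "x c \<noteq> z c"
    using first_diff_witness[OF assms(1)] by blast
  then have yc: "y c \<noteq> z c" using * by simp
  then show na: "\<not> agree a y z" using c by (auto simp: agree_def)
  have "first_diff a y z \<le> first_diff a x z"
    using first_diff_le[OF c(1), of y z] yc c(2) by simp
  moreover have "first_diff a x z \<le> first_diff a y z"
  proof (rule first_diff_ge[OF na])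
    fix d assume "d \<sqsubset> a" "idx a d < first_diff a x z"
    then show "y d = z d"
      using *[of d] first_diff_le[of d a x z] by force
  qed
  ultimately show "first_diff a y z = first_diff a x z" by simp
qed

lemma first_diff_agree:
  assumes "agree a x y"
  shows "first_diff a x z = first_diff a y z"
proof -
  have "(\<lambda>k. \<exists>c. c \<sqsubset> a \<and> idx a c = k \<and> x c \<noteq> z c) = (\<lambda>k. \<exists>c. c \<sqsubset> a \<and> idx a c = k \<and> y c \<noteq> z c)"
    using assms by (fastforce simp: agree_def)
  then show ?thesis by (simp add: first_diff_def)
qed

text \<open>The data of a stage \<open>a\<close>: the point of \<open>2\<^sup>a\<close> that is split; a map that decides on which side of
  the split a point \<open>x\<close> lies, as a function of the first difference between \<open>x\<close> and the split point in
  an enumeration of the coordinates below \<open>a\<close>; and two sets of indices along which the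
  sequence guessed at stage \<open>a\<close> accumulates at the split point.\<close>

type_synonym 'j stage = "('j \<Rightarrow> bool) \<times> (nat \<Rightarrow> bool) \<times> (bool \<Rightarrow> nat set)"

definition pt :: "'i stage \<Rightarrow> 'i \<Rightarrow> bool" where "pt = fst"
definition side :: "'i stage \<Rightarrow> nat \<Rightarrow> bool" where "side = fst \<circ> snd"
definition part :: "'i stage \<Rightarrow> bool \<Rightarrow> nat set" where "part = snd \<circ> snd"

text \<open>Coordinate \<open>b\<close> is prescribed off the split point and free at it, which
  splits that point in two. For \<open>J = below a\<close> this is the preimage in the full cube of
  the space \<open>X\<^sub>a\<close>.\<close>

definition points :: "('i \<Rightarrow> 'i stage) \<Rightarrow> 'i set \<Rightarrow> ('i \<Rightarrow> bool) set" where
  "points D J = {x. \<forall>b\<in>J. \<not> agree b x (pt (D b)) \<longrightarrow>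
                       x b = side (D b) (first_diff b x (pt (D b)))}"

abbreviation below :: "'i \<Rightarrow> 'i set" where "below a \<equiv> {b. b \<sqsubset> a}"

definition registered :: "('i \<Rightarrow> 'i stage) \<Rightarrow> 'i \<Rightarrow> bool" where
  "registered D a \<longleftrightarrow> (\<forall>n. t a n \<in> points D (below a)) \<and>
     (\<forall>m n. m \<noteq> n \<longrightarrow> \<not> agree a (t a m) (t a n))"

text \<open>The last clause keeps the terms off the split point: a coordinate where a term differs
  from it bounds the first differences over the whole fibre, and accumulation then involves
  infinitely many indices.\<close>

definition cluster_data :: "('i \<Rightarrow> 'i stage) \<Rightarrow> 'i \<Rightarrow> bool" where
  "cluster_data D a \<longleftrightarrow> part (D a) True \<inter> part (D a) False = {} \<and>
     (\<forall>i S. finite S \<longrightarrow> S \<subseteq> below a \<longrightarrow> (\<exists>n\<in>part (D a) i. \<forall>c\<in>S. t a n c = pt (D a) c)) \<and>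
     (\<forall>i. \<forall>n\<in>part (D a) i. \<not> agree a (t a n) (pt (D a)))"

lemma cluster_apart:
  assumes "cluster_data D a" "n \<in> part (D a) i"
  shows "\<exists>c. c \<sqsubset> a \<and> t a n c \<noteq> pt (D a) c"
proof -
  have "\<forall>i. \<forall>n\<in>part (D a) i. \<not> agree a (t a n) (pt (D a))"
    using assms(1) by (simp add: cluster_data_def)
  then have "\<not> agree a (t a n) (pt (D a))" using assms(2) by blast
  then show ?thesis by (simp add: agree_def)
qed

text \<open>Preserves the accumulation begun at \<open>g\<close> through the splitting at
  \<open>a\<close>: arbitrarily close to \<open>pt (D a)\<close> there are whole fibres over terms
  guessed at \<open>g\<close>, from each part, that are sent to a prescribed side.\<close>

definition split_data :: "('i \<Rightarrow> 'i stage) \<Rightarrow> 'i \<Rightarrow> 'i \<Rightarrow> bool" where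
  "split_data D a g \<longleftrightarrow>
     (\<forall>i k b. \<exists>n\<in>part (D g) i. \<forall>x\<in>points D (below a). agree g x (t g n) \<longrightarrow>
        \<not> agree a x (pt (D a)) \<and> k \<le> first_diff a x (pt (D a)) \<and>
        side (D a) (first_diff a x (pt (D a))) = b)"

text \<open>The last clause concerns the stages \<open>g\<close> whose split point lies under the
  new one, since accumulation has to survive at the points over \<open>pt (D g)\<close>. The case
  \<open>g = a\<close> yields it at the two new points.\<close>

definition good :: "('i \<Rightarrow> 'i stage) \<Rightarrow> 'i \<Rightarrow> bool" where
  "good D a \<longleftrightarrow> pt (D a) \<in> points D (below a) \<and> (registered D a \<longrightarrow> cluster_data D a) \<and>
     (\<forall>g. g = a \<or> g \<sqsubset> a \<longrightarrow> registered D g \<longrightarrow> agree g (pt (D a)) (pt (D g)) \<longrightarrow> split_data D a g)"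

section \<open>Locality of the conditions on a stage\<close>

lemma points_cong: "(\<And>b. b \<in> J \<Longrightarrow> D b = D' b) \<Longrightarrow> points D J = points D' J"
  by (auto simp: points_def)

lemma registered_cong: "(\<And>b. b \<sqsubset> a \<Longrightarrow> D b = D' b) \<Longrightarrow> registered D a = registered D' a"
  using points_cong[of "below a" D D'] by (simp add: registered_def)

text \<open>All conditions at \<open>a\<close> refer to \<open>D\<close> only at \<open>a\<close>
  and below, which allows the stages to be chosen by well-founded recursion.\<close>

lemma good_cong:
  assumes "\<And>b. b = a \<or> b \<sqsubset> a \<Longrightarrow> D b = D' b"
  shows "good D a = good D' a"
proof -
  have p: "points D (below a) = points D' (below a)"
    by (rule points_cong) (simp add: assms)
  have r: "registered D g = registered D' g" if "g = a \<or> g \<sqsubset> a" for g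
    by (rule registered_cong) (use that assms trans in blast)
  have s: "split_data D a g = split_data D' a g" if "g = a \<or> g \<sqsubset> a" for g
    using that assms[of a] assms[of g] by (simp add: split_data_def p)
  show ?thesis
    unfolding good_def using p r s assms by (auto simp: cluster_data_def)
qed

lemma points_antimono: "J \<subseteq> J' \<Longrightarrow> points D J' \<subseteq> points D J"
  by (auto simp: points_def)

lemma points_agree:
  assumes "x \<in> points D (below a)" "agree a x y"
  shows "y \<in> points D (below a)"
  unfolding points_def
proof (intro CollectI ballI impI)
  fix b assume b: "b \<in> below a" "\<not> agree b y (pt (D b))"
  then have xy: "agree b x y" "x b = y b"
    using assms(2) agree_mono by (auto simp: agree_def)
  then have "\<not> agree b x (pt (D b))"
    using b(2) by (auto simp: agree_def)
  then show "y b = side (D b) (first_diff b y (pt (D b)))"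
    using assms(1) b(1) xy(2) first_diff_agree[OF xy(1)] by (simp add: points_def)
qed

text \<open>Neighbourhoods of \<open>pt (D g)\<close> swallow whole fibres over the points of the guessed sequence,
  however the latter are split at later stages.\<close>

lemma fibre_in_neighbourhood:
  assumes good: "\<And>b. b \<sqsubset> d \<Longrightarrow> good D b"
    and g: "g \<in> I" "registered D g" "cluster_data D g"
    and x: "x \<in> points D (below d)" "agree g x (pt (D g))"
    and S: "finite S" "S \<subseteq> below d"
  shows "\<exists>n\<in>part (D g) i. \<forall>y\<in>points D (below d). agree g y (t g n) \<longrightarrow> (\<forall>c\<in>S. y c = x c)"
  using good x S
proof (induction d arbitrary: S rule: lt_induct)
  case (less d)
  show ?case
  proof (cases "S \<subseteq> below g")
    case True
    then obtain n where n: "n \<in> part (D g) i" "\<forall>c\<in>S. t g n c = pt (D g) c"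
      using g(3)[unfolded cluster_data_def, THEN conjunct2, THEN conjunct1, rule_format, OF less(5) True, of i]
      by blast
    then have "\<forall>y. agree g y (t g n) \<longrightarrow> (\<forall>c\<in>S. y c = x c)"
      using True less(4) by (auto simp: agree_def)
    then show ?thesis using n(1) by blast
  next
    case False
    then obtain s where s: "s \<in> S" "\<not> s \<sqsubset> g" by blast
    \<comment> \<open>The largest coordinate \<open>a\<close> of \<open>S\<close> is treated apart;
      the remaining ones lie below it, where the induction hypothesis is available.\<close>
    have "\<exists>a\<in>S. \<forall>c\<in>S. c = a \<or> c \<sqsubset> a"
    proof -
      have "finite S \<Longrightarrow> S \<noteq> {} \<Longrightarrow> S \<subseteq> I \<Longrightarrow> \<exists>a\<in>S. \<forall>c\<in>S. c = a \<or> c \<sqsubset> a"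
      proof (induction S rule: finite_ne_induct)
        case (insert b F)
        then obtain a where a: "a \<in> F" "\<forall>c\<in>F. c = a \<or> c \<sqsubset> a" by auto
        have "a \<sqsubset> b \<or> a = b \<or> b \<sqsubset> a" using total[of a b] insert.prems a(1) by blast
        then consider "a \<sqsubset> b" | "a = b" | "b \<sqsubset> a" by blast
        then show ?case
        proof cases
          case 1
          then have "\<forall>c\<in>F. c \<sqsubset> b" using a(2) trans[of _ a b] by auto
          then show ?thesis by blast
        qed (use a in blast)+
      qed simp
      moreover have "S \<subseteq> I" using less(6) field by blast
      ultimately show ?thesis using less(5) s by blast
    qed
    then obtain a where a: "a \<in> S" "\<And>c. c \<in> S \<Longrightarrow> c = a \<or> c \<sqsubset> a" by blast
    have ad: "a \<sqsubset> d" using a(1) less(6) by blast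
    have sub: "points D (below d) \<subseteq> points D (below a)"
      by (rule points_antimono) (use ad trans in blast)
    have constr: "\<not> agree a y (pt (D a)) \<Longrightarrow> y a = side (D a) (first_diff a y (pt (D a)))"
      if "y \<in> points D (below d)" for y
      using that ad by (auto simp: points_def)
    have ga: "g = a \<or> g \<sqsubset> a \<or> a \<sqsubset> g"
      using total[of g a] field[OF ad] g(1) by blast
    have "\<not> a \<sqsubset> g"
      using a(2)[OF s(1)] s(2) trans by blast
    with ga have ga: "g = a \<or> g \<sqsubset> a" by blast
    \<comment> \<open>Over the split point of stage \<open>a\<close>, \<open>split_data\<close>
      supplies fibres on the side \<open>x a\<close>; off it, the value at \<open>a\<close> is
      determined by finitely many smaller coordinates.\<close>
    show ?thesis
    proof (cases "agree a x (pt (D a))")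
      case True
      have "agree g (pt (D a)) (pt (D g))"
        using ga True less(4) trans by (auto simp: agree_def)
      then have sp: "split_data D a g"
        using less(2)[OF ad] g(2) ga by (auto simp: good_def)
      obtain k where k: "\<And>c. c \<in> S - {a} \<Longrightarrow> idx a c < k"
        using finite_nat_set_iff_bounded[of "idx a ` (S - {a})"] less(5) by auto
      obtain n where n: "n \<in> part (D g) i" and
        nn: "\<And>y. y \<in> points D (below a) \<Longrightarrow> agree g y (t g n) \<Longrightarrow>
        \<not> agree a y (pt (D a)) \<and> k \<le> first_diff a y (pt (D a)) \<and>
        side (D a) (first_diff a y (pt (D a))) = x a"
        using sp[unfolded split_data_def, rule_format, of i k "x a"] by blast
      have "y c = x c" if y: "y \<in> points D (below d)" "agree g y (t g n)" and c: "c \<in> S" for y c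
      proof (cases "c = a")
        case True
        then show ?thesis using constr[OF y(1)] nn[of y] y sub by auto
      next
        case False
        then have ca: "c \<sqsubset> a" "idx a c < k" using a(2) c k by auto
        then have "y c = pt (D a) c"
          using first_diff_le[OF ca(1), of y "pt (D a)"] nn[of y] y sub by force
        then show ?thesis using \<open>agree a x (pt (D a))\<close> ca by (simp add: agree_def)
      qed
      then show ?thesis using n by blast
    next
      case na: False
      \<comment> \<open>Coordinate \<open>a\<close> is traded for the coordinates that determine the
        first difference of \<open>x\<close> with the split point, and hence the value at
        \<open>a\<close>.\<close>
      define S' where "S' = (S - {a}) \<union> {c. c \<sqsubset> a \<and> idx a c \<le> first_diff a x (pt (D a))}"
      have "finite S'" "S' \<subseteq> below a"
        using less(5) a(2) finite_idx_le by (auto simp: S'_def)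
      moreover have "good D b" if "b \<sqsubset> a" for b
        using that ad trans less(2) by blast
      ultimately obtain n where n: "n \<in> part (D g) i" and
        nn: "\<And>y. y \<in> points D (below a) \<Longrightarrow> agree g y (t g n) \<Longrightarrow> (\<forall>c\<in>S'. y c = x c)"
        using less(1)[OF ad, of S'] subsetD[OF sub less(3)] less(4) by auto
      have "y c = x c" if y: "y \<in> points D (below d)" "agree g y (t g n)" and c: "c \<in> S" for y c
      proof (cases "c = a")
        case True
        have "\<And>c. c \<sqsubset> a \<Longrightarrow> idx a c \<le> first_diff a x (pt (D a)) \<Longrightarrow> y c = x c"
          using nn[of y] y sub by (auto simp: S'_def)
        note first_diff_cong[OF na this]
        then show ?thesis
          using True constr[OF y(1)] constr[OF less(3) na] by simp
      next
        case False
        then show ?thesis using nn[of y] y sub c by (auto simp: S'_def)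
      qed
      then show ?thesis using n by blast
    qed
  qed
qed


text \<open>Projections of the inverse limit are surjective: the coordinates outside
  \<open>J\<close> are filled in by recursion, and no conflict arises because the constraint at
  \<open>c\<close> determines at most the value at \<open>c\<close> from smaller
  coordinates.\<close>

lemma ex_extension:
  assumes J: "\<And>b c. b \<in> J \<Longrightarrow> c \<sqsubset> b \<Longrightarrow> c \<in> J" "J \<subseteq> I" and x: "x \<in> points D J"
  obtains x' where "x' \<in> points D I" "\<And>c. c \<in> J \<Longrightarrow> x' c = x c" "\<And>c. c \<notin> I \<Longrightarrow> \<not> x' c"
proof -
  define P where "P f c r \<longleftrightarrow> (if c \<in> J then r = x c else if c \<notin> I then r = False
      else \<not> agree c f (pt (D c)) \<longrightarrow> r = side (D c) (first_diff c f (pt (D c))))" for f c r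
  have "\<exists>f. \<forall>c. P f c (f c)"
  proof (rule dependent_wf_choice[OF wf])
    fix f g :: "'i \<Rightarrow> bool" and c r
    assume "\<And>z. (z, c) \<in> {(a, b). a \<sqsubset> b} \<Longrightarrow> f z = g z"
    then have fg: "agree c f g" by (simp add: agree_def)
    then have "agree c f z = agree c g z" for z by (auto simp: agree_def)
    then show "P f c r = P g c r"
      using first_diff_agree[OF fg] by (simp add: P_def)
  qed (auto simp: P_def)
  then obtain f where f: "\<And>c. P f c (f c)" by blast
  have fJ: "f c = x c" if "c \<in> J" for c
    using f[of c] that by (simp add: P_def)
  have "f \<in> points D I"
    unfolding points_def
  proof (intro CollectI ballI impI)
    fix b assume b: "b \<in> I" "\<not> agree b f (pt (D b))"
    show "f b = side (D b) (first_diff b f (pt (D b)))"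
    proof (cases "b \<in> J")
      case True
      then have fx: "agree b f x" using J(1) fJ by (auto simp: agree_def)
      then have "\<not> agree b x (pt (D b))" using b(2) by (auto simp: agree_def)
      then show ?thesis
        using x True fJ first_diff_agree[OF fx] by (simp add: points_def)
    next
      case False
      then show ?thesis using f[of b] b by (simp add: P_def)
    qed
  qed
  moreover have "\<not> f c" if "c \<notin> I" for c
    using f[of c] that J(2) by (auto simp: P_def split: if_splits)
  ultimately show thesis using that fJ by blast
qed

text \<open>The constraint at each \<open>b\<close> reads only finitely many coordinates, so it
  passes from the terms \<open>s n\<close> that approximate \<open>z\<close> to \<open>z\<close>
  itself.\<close>

lemma points_cluster:
  assumes s: "\<And>n. s n \<in> points D (below a)"
    and z: "\<And>S. finite S \<Longrightarrow> S \<subseteq> below a \<Longrightarrow> \<exists>n. \<forall>c\<in>S. s n c = z c"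
  shows "z \<in> points D (below a)"
  unfolding points_def
proof (intro CollectI ballI impI)
  fix b assume b: "b \<in> below a" "\<not> agree b z (pt (D b))"
  define S where "S = insert b {c. c \<sqsubset> b \<and> idx b c \<le> first_diff b z (pt (D b))}"
  have "finite S" using finite_idx_le by (simp add: S_def)
  moreover have "S \<subseteq> below a" using b(1) trans by (auto simp: S_def)
  ultimately obtain n where n: "\<forall>c\<in>S. s n c = z c" using z by blast
  have "\<And>c. c \<sqsubset> b \<Longrightarrow> idx b c \<le> first_diff b z (pt (D b)) \<Longrightarrow> s n c = z c"
    using n by (auto simp: S_def)
  note first_diff_cong[OF b(2) this]
  then show "z b = side (D b) (first_diff b z (pt (D b)))"
    using s[of n] b n by (auto simp: points_def S_def)
qed

text \<open>Below \<open>a\<close> there are only countably many coordinates, so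
  \<open>2\<^sup>a\<close> is compact and metrizable and a subsequence converges. Its even and odd
  terms accumulate at the limit; at most one term equals the limit, and the terms up to it are
  dropped.\<close>

lemma ex_cluster_data:
  fixes s :: "nat \<Rightarrow> 'i \<Rightarrow> bool"
  assumes inj: "\<And>m n. m \<noteq> n \<Longrightarrow> \<not> agree a (s m) (s n)"
  shows "\<exists>z A. A True \<inter> A False = {} \<and>
    (\<forall>i S. finite S \<longrightarrow> S \<subseteq> below a \<longrightarrow> (\<exists>n\<in>A i. \<forall>c\<in>S. s n c = z c)) \<and>
    (\<forall>i::bool. \<forall>n\<in>A i. \<not> agree a (s n) z)"
proof -
  define v where "v n = (\<lambda>k. if \<exists>c. c \<sqsubset> a \<and> idx a c = k \<and> s n c then 1 else 0 :: real)" for n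
  have v: "v n (idx a c) = of_bool (s n c)" if "c \<sqsubset> a" for n c
  proof -
    have "d = c" if "d \<sqsubset> a" "idx a d = idx a c" for d
      using inj_on_to_nat_on[OF countable_below[of a]] that \<open>c \<sqsubset> a\<close> by (auto simp: inj_on_def idx_def)
    then show ?thesis using \<open>c \<sqsubset> a\<close> by (auto simp: v_def)
  qed
  have "compact (PiE UNIV (\<lambda>_::nat. {0..1::real}))"
    using compactin_PiE[of "\<lambda>_. euclideanreal" UNIV "\<lambda>_::nat. {0..1::real}"]
    by (simp add: euclidean_product_topology)
  then have "seq_compact (PiE UNIV (\<lambda>_::nat. {0..1::real}))"
    by (simp add: compact_eq_seq_compact_metric)
  moreover have "v n \<in> PiE UNIV (\<lambda>_. {0..1})" for n
    by (auto simp: v_def)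
  ultimately obtain l r where l: "strict_mono r" "(v \<circ> r) \<longlonglongrightarrow> l"
    unfolding seq_compact_def by metis
  have lim: "(\<lambda>n. v (r n) k) \<longlonglongrightarrow> l k" for k
    using continuous_on_tendsto_compose[OF continuous_on_product_coordinates l(2), of k]
    by (simp add: o_def)
  define z where "z c \<longleftrightarrow> l (idx a c) > 1/2" for c
  have ev: "\<forall>\<^sub>F n in sequentially. s (r n) c = z c" if "c \<sqsubset> a" for c
  proof -
    have "\<forall>\<^sub>F n in sequentially. dist (v (r n) (idx a c)) (l (idx a c)) < 1/2"
      using tendstoD[OF lim, of "1/2"] by simp
    then show ?thesis
    proof eventually_elim
      case (elim n)
      show ?case
        using elim by (cases "s (r n) c") (auto simp: v[OF that] z_def dist_real_def abs_if split: if_splits)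
    qed
  qed
  have "\<exists>k. \<forall>n>k. \<not> agree a (s (r n)) z"
  proof (cases "\<exists>k. agree a (s (r k)) z")
    case True
    then obtain k where k: "agree a (s (r k)) z" by blast
    have "\<not> agree a (s (r n)) z" if "n > k" for n
    proof
      assume "agree a (s (r n)) z"
      then have "agree a (s (r n)) (s (r k))" using k by (simp add: agree_def)
      moreover have "r n \<noteq> r k" using that strict_mono_eq[OF l(1)] by simp
      ultimately show False using inj by blast
    qed
    then show ?thesis by blast
  qed blast
  then obtain k where k: "\<And>n. n > k \<Longrightarrow> \<not> agree a (s (r n)) z" by blast
  define A where "A i = {r n | n. n > k \<and> even n = i}" for i
  show ?thesis
  proof (intro exI conjI allI ballI impI)
    show "A True \<inter> A False = {}"
      using strict_mono_eq[OF l(1)] by (auto simp: A_def)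
    show "\<not> agree a (s n) z" if "n \<in> A i" for i n
      using that k by (auto simp: A_def)
    show "\<exists>n\<in>A i. \<forall>c\<in>S. s n c = z c" if S: "finite S" "S \<subseteq> below a" for i S
    proof -
      have "\<forall>\<^sub>F n in sequentially. \<forall>c\<in>S. s (r n) c = z c"
        using S ev by (auto simp: eventually_ball_finite_distrib)
      then obtain N where N: "\<And>n c. n \<ge> N \<Longrightarrow> c \<in> S \<Longrightarrow> s (r n) c = z c"
        unfolding eventually_sequentially by blast
      define n where "n = 2 * (N + k) + (if i then 2 else 1)"
      have "n > k" "even n = i" "n \<ge> N" by (auto simp: n_def)
      then have "r n \<in> A i" "n \<ge> N" unfolding A_def by blast+
      then show ?thesis using N by blast
    qed
  qed
qed

text \<open>The split point \<open>z\<close> and the index sets \<open>A\<close> come first: a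
  cluster point of the guessed sequence if the stage is registered, any point otherwise. The side
  map is chosen last, to meet countably many demands from earlier stages and the new one.\<close>

lemma ex_good_step:
  assumes good: "\<And>b. b \<sqsubset> a \<Longrightarrow> good D b" and "a \<in> I"
  shows "\<exists>d. good (D(a := d)) a"
proof -
  let ?D = "\<lambda>d. D(a := d)"
  have pts: "points (?D d) (below b) = points D (below b)" if "b = a \<or> b \<sqsubset> a" for b d
    by (rule points_cong) (use that irrefl trans in auto)
  have reg: "registered (?D d) b = registered D b" if "b = a \<or> b \<sqsubset> a" for b d
    by (rule registered_cong) (use that irrefl trans in auto)
  have goodD: "good (?D d) b" if "b \<sqsubset> a" for b d
    using good[OF that] good_cong[of b D "?D d"] that irrefl trans by (metis fun_upd_other)
  obtain z A where z: "z \<in> points D (below a)"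
    and cl: "\<And>e. registered D a \<longrightarrow> cluster_data (?D (z, e, A)) a"
  proof (cases "registered D a")
    case True
    then have "\<exists>z A. A True \<inter> A False = {} \<and>
        (\<forall>i S. finite S \<longrightarrow> S \<subseteq> below a \<longrightarrow> (\<exists>n\<in>A i. \<forall>c\<in>S. t a n c = z c)) \<and>
        (\<forall>i::bool. \<forall>n\<in>A i. \<not> agree a (t a n) z)"
      by (intro ex_cluster_data) (simp add: registered_def)
    then obtain z A where zA: "A True \<inter> A False = {}"
      "\<forall>i S. finite S \<longrightarrow> S \<subseteq> below a \<longrightarrow> (\<exists>n\<in>A i. \<forall>c\<in>S. t a n c = z c)"
      "\<forall>i::bool. \<forall>n\<in>A i. \<not> agree a (t a n) z" by (elim exE conjE)
    have "z \<in> points D (below a)"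
    proof (rule points_cluster[of "t a"])
      show "\<exists>n. \<forall>c\<in>S. t a n c = z c" if "finite S" "S \<subseteq> below a" for S
        using zA(2)[rule_format, OF that, of True] by blast
    qed (use True in \<open>simp add: registered_def\<close>)
    moreover have "cluster_data (?D (z, e, A)) a" for e
      using zA by (simp add: cluster_data_def pt_def part_def)
    ultimately show thesis using that by blast
  next
    case False
    obtain x where "x \<in> points D I"
      by (rule ex_extension[of "{}" "\<lambda>_. False" D]) (auto simp: points_def)
    then have "x \<in> points D (below a)" using points_antimono[of "below a" I D] field by blast
    then show thesis using that False by blast
  qed
  \<comment> \<open>The pairs of a stage and a part on which \<open>split_data\<close> makes a
    demand. The constant side map is a placeholder, since \<open>pt\<close> and \<open>part\<close>
    do not read it.\<close>
  define Q where "Q = {(g, i::bool). (g = a \<or> g \<sqsubset> a) \<and> registered D g \<and>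
      agree g z (pt (?D (z, \<lambda>_. False, A) g))}"
  \<comment> \<open>Some fibre demanded by the pair has all its first differences from
    \<open>z\<close> in the window from \<open>k\<close> up to but excluding \<open>l\<close>; a
    side map constant on the window sends it to one side.\<close>
  define F where "F = (\<lambda>(g, i) k l. \<exists>n\<in>part (?D (z, \<lambda>_. False, A) g) i. \<forall>x\<in>points D (below a).
      agree g x (t g n) \<longrightarrow> \<not> agree a x z \<and> k \<le> first_diff a x z \<and> first_diff a x z < l)"
  have "Q \<subseteq> insert a (below a) \<times> UNIV" by (auto simp: Q_def)
  then have cQ: "countable Q"
    by (rule countable_subset) (simp add: countable_below)
  have exF: "\<exists>l. F p k l" if "p \<in> Q" for p k
  proof -
    obtain g i where p: "p = (g, i)" by force
    let ?E = "?D (z, \<lambda>_. False, A)"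
    have g: "g = a \<or> g \<sqsubset> a" "registered D g" "agree g z (pt (?E g))"
      using that by (auto simp: Q_def p)
    have cg: "cluster_data ?E g"
    proof (cases "g = a")
      case True
      then show ?thesis using cl g by blast
    next
      case False
      then show ?thesis using g goodD[of g] reg[of g] by (auto simp: good_def)
    qed
    have "g \<in> I" using g(1) \<open>a \<in> I\<close> field by blast
    have "\<exists>n\<in>part (?E g) i. \<forall>y\<in>points ?E (below a). agree g y (t g n) \<longrightarrow>
        (\<forall>c\<in>{c. c \<sqsubset> a \<and> idx a c \<le> k}. y c = z c)"
    proof (rule fibre_in_neighbourhood)
      show "registered ?E g" using reg[OF g(1)] g(2) by blast
      show "z \<in> points ?E (below a)" using pts[of a] z by blast
      show "cluster_data ?E g" by (fact cg)
      show "good ?E b" if "b \<sqsubset> a" for b using goodD[OF that] .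
    qed (use \<open>g \<in> I\<close> g(3) finite_idx_le in auto)
    then obtain n where n1: "n \<in> part (?E g) i" and n2: "\<forall>y\<in>points ?E (below a).
        agree g y (t g n) \<longrightarrow> (\<forall>c\<in>{c. c \<sqsubset> a \<and> idx a c \<le> k}. y c = z c)"
      by (elim bexE)
    have n: "n \<in> part (?E g) i"
      "\<And>y c. y \<in> points D (below a) \<Longrightarrow> agree g y (t g n) \<Longrightarrow> c \<sqsubset> a \<Longrightarrow> idx a c \<le> k \<Longrightarrow> y c = z c"
      using n1 n2[unfolded pts[OF disjI1[OF refl]]] by simp_all
    \<comment> \<open>At \<open>c\<close> the term differs from the split point of \<open>g\<close>,
      hence its whole fibre differs from \<open>z\<close> there, which bounds the first differences
      by \<open>idx a c\<close>.\<close>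
    obtain c where c: "c \<sqsubset> g" "t g n c \<noteq> pt (?E g) c"
      using cluster_apart[OF cg n(1)] by blast
    then have ca: "c \<sqsubset> a" using g(1) trans by blast
    have "\<not> agree a x z \<and> k \<le> first_diff a x z \<and> first_diff a x z < Suc (idx a c)"
      if x: "x \<in> points D (below a)" "agree g x (t g n)" for x
    proof -
      have xc: "x c \<noteq> z c" using c x(2) g(3) by (auto simp: agree_def)
      then have "\<not> agree a x z" using ca by (auto simp: agree_def)
      moreover have "k \<le> first_diff a x z"
        by (rule first_diff_ge[OF calculation]) (use n(2)[OF x] in simp)
      ultimately show ?thesis using first_diff_le[of c a x z] ca xc by simp
    qed
    then have "F p k (Suc (idx a c))" using n(1) unfolding F_def p case_prod_conv by blast
    then show ?thesis by blast
  qed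
  have "\<exists>e::nat \<Rightarrow> bool. \<forall>p\<in>Q. \<forall>k b. \<exists>k'\<ge>k. \<exists>l. F p k' l \<and> (\<forall>j. k' \<le> j \<and> j < l \<longrightarrow> e j = b)"
    using cQ exF by (rule ex_prescribed_on_blocks)
  then obtain e :: "nat \<Rightarrow> bool" where
    e: "\<forall>p\<in>Q. \<forall>k b. \<exists>k'\<ge>k. \<exists>l. F p k' l \<and> (\<forall>j. k' \<le> j \<and> j < l \<longrightarrow> e j = b)"
    by (elim exE)
  let ?E = "?D (z, e, A)"
  have "split_data ?E a g" if g: "g = a \<or> g \<sqsubset> a" "registered D g" "agree g z (pt (?E g))" for g
    unfolding split_data_def
  proof (intro allI)
    fix i k b
    have "(g, i) \<in> Q" using g by (auto simp: Q_def pt_def)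
    from e[rule_format, OF this, of k b] obtain k' l where k': "k' \<ge> k" "F (g, i) k' l" "\<And>j. k' \<le> j \<Longrightarrow> j < l \<Longrightarrow> e j = b"
      by blast
    then obtain n where n: "n \<in> part (?D (z, \<lambda>_. False, A) g) i" "\<And>x. x \<in> points D (below a) \<Longrightarrow>
      agree g x (t g n) \<Longrightarrow> \<not> agree a x z \<and> k' \<le> first_diff a x z \<and> first_diff a x z < l"
      unfolding F_def case_prod_conv by blast
    have "n \<in> part (?E g) i" using n(1) by (cases "g = a") (auto simp: part_def)
    moreover have "\<not> agree a x (pt (?E a)) \<and> k \<le> first_diff a x (pt (?E a)) \<and>
        side (?E a) (first_diff a x (pt (?E a))) = b"
      if "x \<in> points ?E (below a)" "agree g x (t g n)" for x
    proof -
      have "x \<in> points D (below a)" using that pts by blast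
      note * = n(2)[OF this that(2)]
      then show ?thesis using k' by (auto simp: pt_def side_def)
    qed
    ultimately show "\<exists>n\<in>part (?E g) i. \<forall>x\<in>points ?E (below a). agree g x (t g n) \<longrightarrow>
        \<not> agree a x (pt (?E a)) \<and> k \<le> first_diff a x (pt (?E a)) \<and>
        side (?E a) (first_diff a x (pt (?E a))) = b" by blast
  qed
  moreover have "pt (?E a) = z" by (simp add: pt_def)
  ultimately have "good ?E a"
    using z cl reg pts by (simp add: good_def)
  then show ?thesis by blast
qed

section \<open>The limit space\<close>

lemma ex_good: "\<exists>D. \<forall>a\<in>I. good D a"
proof -
  define P where "P f a d \<longleftrightarrow> a \<in> I \<longrightarrow> good (f(a := d)) a" for f a d
  have "\<exists>f. \<forall>a. P f a (f a)"
  proof (rule dependent_wf_choice[OF wf])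
    fix f g :: "'i \<Rightarrow> 'i stage" and a d
    assume "\<And>z. (z, a) \<in> {(a, b). a \<sqsubset> b} \<Longrightarrow> f z = g z"
    then have "good (f(a := d)) a = good (g(a := d)) a"
      by (intro good_cong) auto
    then show "P f a d = P g a d" by (simp add: P_def)
  next
    fix a and f :: "'i \<Rightarrow> 'i stage"
    assume "\<And>b. (b, a) \<in> {(a, b). a \<sqsubset> b} \<Longrightarrow> P f b (f b)"
    then have "\<And>b. b \<sqsubset> a \<Longrightarrow> good f b" using field by (auto simp: P_def)
    then show "\<exists>d. P f a d" using ex_good_step[of a f] by (auto simp: P_def)
  qed
  then show ?thesis by (auto simp: P_def)
qed

definition clusters :: "('i \<Rightarrow> bool) \<Rightarrow> (nat \<Rightarrow> 'i \<Rightarrow> bool) \<Rightarrow> nat set \<Rightarrow> bool" where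
  "clusters p s A \<longleftrightarrow> (\<forall>S. finite S \<longrightarrow> infinite {n\<in>A. \<forall>c\<in>S. s n c = p c})"

text \<open>The terms of an injective sequence are already distinct below some \<open>a0\<close>, so
  a guess of it at a later \<open>a\<close> is registered. Points of \<open>L\<close> over the split
  point of \<open>a\<close> with different values at \<open>a\<close> serve as \<open>p\<close> and
  \<open>q\<close>.\<close>

lemma ex_fedorchuk:
  "\<exists>L :: ('i \<Rightarrow> bool) set. infinite L \<and>
     (\<forall>x. (\<forall>S. finite S \<longrightarrow> (\<exists>y\<in>L. \<forall>c\<in>S. y c = x c)) \<longrightarrow> x \<in> L) \<and>
     (\<forall>s. inj s \<longrightarrow> range s \<subseteq> L \<longrightarrow>
       (\<exists>A B p q. A \<inter> B = {} \<and> p \<in> L \<and> q \<in> L \<and> p \<noteq> q \<and>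
         clusters p s A \<and> clusters p s B \<and> clusters q s A \<and> clusters q s B))"
proof -
  obtain D where D: "\<And>a. a \<in> I \<Longrightarrow> good D a" using ex_good by blast
  define L where "L = {x \<in> points D I. \<forall>c. c \<notin> I \<longrightarrow> \<not> x c}"
  have L_below: "x \<in> points D (below a)" if "x \<in> L" for x a
    using that points_antimono[of "below a" I D] field by (auto simp: L_def)
  have split: "\<exists>p. p \<in> L \<and> agree a p (pt (D a)) \<and> p a = v" if a: "a \<in> I" for a v
  proof -
    \<comment> \<open>The constraint at \<open>a\<close> is void at the split point, so either value
      at \<open>a\<close> is admissible.\<close>
    let ?x = "(pt (D a))(a := v)"
    have ag: "agree b ?x (pt (D a))" if "b = a \<or> b \<sqsubset> a" for b
      using that irrefl trans by (auto simp: agree_def)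
    have "?x \<in> points D (below a)"
      using D[OF a] ag[of a] points_agree[of "pt (D a)" D a ?x] by (simp add: good_def agree_def)
    then have "?x \<in> points D (insert a (below a))"
      using ag[of a] by (auto simp: points_def)
    then obtain p where p: "p \<in> points D I" "\<And>c. c \<in> insert a (below a) \<Longrightarrow> p c = ?x c"
      "\<And>c. c \<notin> I \<Longrightarrow> \<not> p c"
      using ex_extension[of "insert a (below a)" ?x D] trans field a by blast
    then have "agree a p (pt (D a))" "p a = v"
      using irrefl by (auto simp: agree_def)
    then show ?thesis using p by (auto simp: L_def)
  qed
  have sep: "\<exists>c\<in>I. x c \<noteq> y c" if "x \<in> L" "y \<in> L" "x \<noteq> y" for x y
    using that by (auto simp: L_def fun_eq_iff)
  show ?thesis
  proof (intro exI[of _ L] conjI allI impI)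
    show "infinite L"
    proof
      assume fin: "finite L"
      obtain d where d: "\<And>x y. x \<in> L \<Longrightarrow> y \<in> L \<Longrightarrow> x \<noteq> y \<Longrightarrow> d x y \<in> I \<and> x (d x y) \<noteq> y (d x y)"
        using sep by metis
      let ?B = "{d x y | x y. x \<in> L \<and> y \<in> L \<and> x \<noteq> y}"
      have "finite ((\<lambda>(x, y). d x y) ` (L \<times> L))" using fin by simp
      then have "finite ?B" by (rule rev_finite_subset) auto
      moreover have "?B \<subseteq> I" using d by auto
      ultimately have "\<exists>a\<in>I. \<forall>b\<in>?B. b \<sqsubset> a" by (intro bounded countable_finite)
      then obtain a where a: "a \<in> I" "\<forall>b\<in>?B. b \<sqsubset> a" by (elim bexE)
      obtain p q where p: "p \<in> L" "agree a p (pt (D a))" "p a"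
        and q: "q \<in> L" "agree a q (pt (D a))" "\<not> q a"
        using split[OF a(1), of True] split[OF a(1), of False] by blast
      have "p \<noteq> q" using p q by auto
      then have "d p q \<in> ?B" "p (d p q) \<noteq> q (d p q)" using d p(1) q(1) by auto
      moreover from this have "d p q \<sqsubset> a" using a(2) by blast
      ultimately show False using p q by (simp add: agree_def)
    qed
  next
    fix x assume "\<forall>S. finite S \<longrightarrow> (\<exists>y\<in>L. \<forall>c\<in>S. y c = x c)"
    then have x: "\<And>S. finite S \<Longrightarrow> \<exists>y\<in>L. \<forall>c\<in>S. y c = x c" by (elim allE impE)
    have "\<not> x c" if "c \<notin> I" for c
      using x[of "{c}"] that by (auto simp: L_def)
    moreover have "x \<in> points D I"
      unfolding points_def
    proof (intro CollectI ballI impI)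
      fix b assume b: "b \<in> I" "\<not> agree b x (pt (D b))"
      have "finite (insert b {c. c \<sqsubset> b \<and> idx b c \<le> first_diff b x (pt (D b))})"
        using finite_idx_le by simp
      from x[OF this] obtain y where y: "y \<in> L" "y b = x b"
        "\<And>c. c \<sqsubset> b \<Longrightarrow> idx b c \<le> first_diff b x (pt (D b)) \<Longrightarrow> y c = x c" by auto
      note first_diff_cong[OF b(2) y(3)]
      then show "x b = side (D b) (first_diff b x (pt (D b)))"
        using y(1,2) b(1) by (auto simp: L_def points_def)
    qed
    ultimately show "x \<in> L" by (simp add: L_def)
  next
    fix s :: "nat \<Rightarrow> 'i \<Rightarrow> bool" assume s: "inj s" "range s \<subseteq> L"
    have "\<exists>c\<in>I. s m c \<noteq> s n c" if "m \<noteq> n" for m n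
      using sep[of "s m" "s n"] that s by (auto simp: inj_eq)
    then obtain d where d: "\<And>m n. m \<noteq> n \<Longrightarrow> d m n \<in> I \<and> s m (d m n) \<noteq> s n (d m n)" by metis
    let ?B = "{d m n | m n. m \<noteq> n}"
    have "countable ((\<lambda>(m, n). d m n) ` UNIV)" by simp
    then have "countable ?B" by (rule countable_subset[rotated]) auto
    moreover have "?B \<subseteq> I" using d by auto
    ultimately have "\<exists>a\<in>I. \<forall>b\<in>?B. b \<sqsubset> a" by (rule bounded)
    then obtain a0 where a0: "a0 \<in> I" "\<forall>b\<in>?B. b \<sqsubset> a0" by (elim bexE)
    obtain a where a: "a0 \<sqsubset> a" "\<And>n. agree a (t a n) (s n)"
      using guess[OF a0(1), of s] by (auto simp: agree_def)
    have aI: "a \<in> I" using a(1) field by blast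
    have "\<not> agree a (t a m) (t a n)" if "m \<noteq> n" for m n
    proof -
      have "d m n \<sqsubset> a0" using a0(2) that by blast
      then have "d m n \<sqsubset> a" using a(1) trans by blast
      then show ?thesis using d[OF that] a(2)[of m] a(2)[of n] by (auto simp: agree_def)
    qed
    moreover have "t a n \<in> points D (below a)" for n
    proof -
      have "s n \<in> points D (below a)" using L_below s(2) by blast
      then show ?thesis using points_agree a(2)[of n] by (auto simp: agree_def)
    qed
    ultimately have reg: "registered D a" by (simp add: registered_def)
    then have cl: "cluster_data D a" using D[OF aI] by (simp add: good_def)
    have clust: "clusters p s (part (D a) i)" if p: "p \<in> L" "agree a p (pt (D a))" for p i
      unfolding clusters_def
    proof (intro allI impI notI)
      fix S :: "'i set"
      let ?N = "{n \<in> part (D a) i. \<forall>c\<in>S. s n c = p c}"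
      assume S: "finite S" and fin: "finite ?N"
      have "\<exists>c. c \<sqsubset> a \<and> s n c \<noteq> p c" if "n \<in> part (D a) i" for n
        using cluster_apart[OF cl that] a(2)[of n] p(2) by (auto simp: agree_def)
      \<comment> \<open>\<open>w n\<close> is a coordinate at which term \<open>n\<close> differs
        from \<open>p\<close>. Adding these for the supposedly finitely many indices in
        \<open>?N\<close> forces an index outside \<open>?N\<close>, a contradiction.\<close>
      then obtain w where w: "\<And>n. n \<in> part (D a) i \<Longrightarrow> w n \<sqsubset> a \<and> s n (w n) \<noteq> p (w n)" by metis
      define S' where "S' = (S \<union> w ` ?N) \<inter> I"
      have "finite S'" "S' \<subseteq> I" using S fin by (auto simp: S'_def)
      then have "\<exists>e\<in>I. \<forall>b\<in>S'. b \<sqsubset> e" by (intro bounded countable_finite)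
      then obtain e where "\<forall>b\<in>S'. b \<sqsubset> e" by (elim bexE)
      then have e: "S' \<subseteq> below e" by blast
      have "\<exists>n\<in>part (D a) i. \<forall>y\<in>points D (below e). agree a y (t a n) \<longrightarrow> (\<forall>c\<in>S'. y c = p c)"
      proof (rule fibre_in_neighbourhood)
        show "good D b" if "b \<sqsubset> e" for b using D field[OF that] by blast
      qed (use reg cl aI p L_below e \<open>finite S'\<close> in auto)
      then obtain n where n: "n \<in> part (D a) i" "\<And>y c. y \<in> points D (below e) \<Longrightarrow>
          agree a y (t a n) \<Longrightarrow> c \<in> S' \<Longrightarrow> y c = p c" by blast
      have "s n \<in> points D (below e)" using L_below s(2) by blast
      moreover have "agree a (s n) (t a n)" using a(2) by (simp add: agree_def)
      ultimately have sn: "\<And>c. c \<in> S' \<Longrightarrow> s n c = p c" using n(2) by blast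
      have "s n c = p c" if "c \<in> S" for c
      proof (cases "c \<in> I")
        case True
        then show ?thesis using sn that by (simp add: S'_def)
      next
        case False
        then have "\<not> s n c" "\<not> p c" using s(2) p(1) by (auto simp: L_def)
        then show ?thesis by simp
      qed
      then have "n \<in> ?N" using n(1) by blast
      moreover from this have "w n \<in> S'" using w[OF n(1)] field by (auto simp: S'_def)
      ultimately show False using sn w n(1) by blast
    qed
    obtain p q where p: "p \<in> L" "agree a p (pt (D a))" "p a"
      and q: "q \<in> L" "agree a q (pt (D a))" "\<not> q a"
      using split[OF aI, of True] split[OF aI, of False] by blast
    have "p \<noteq> q" using p q by auto
    moreover have "part (D a) True \<inter> part (D a) False = {}"
      using cl by (simp add: cluster_data_def)
    ultimately show "\<exists>A B p q. A \<inter> B = {} \<and> p \<in> L \<and> q \<in> L \<and> p \<noteq> q \<and>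
         clusters p s A \<and> clusters p s B \<and> clusters q s A \<and> clusters q s B"
      using clust p q by blast
  qed
qed

end

lemma guessing_omega1:
  assumes diamond
  obtains t where "guessing omega1_less (Field omega1) t"
proof -
  obtain t :: "nat set \<Rightarrow> nat \<Rightarrow> nat set \<Rightarrow> bool" where
    t: "\<And>a0 s. a0 \<in> Field omega1 \<Longrightarrow>
       \<exists>a. omega1_less a0 a \<and> (\<forall>n c. omega1_less c a \<longrightarrow> t a n c = s n c)"
    using diamond_guesses_sequences[OF assms] by metis
  have "guessing omega1_less (Field omega1) t"
  proof
    show "\<exists>a. omega1_less a0 a \<and> (\<forall>n c. omega1_less c a \<longrightarrow> t a n c = s n c)"
      if "a0 \<in> Field omega1" for a0 s using t[OF that] .
    show "\<exists>a\<in>Field omega1. \<forall>b\<in>B. omega1_less b a" if "countable B" "B \<subseteq> Field omega1" for B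
      using countable_bounded_omega1[OF that] .
    show "countable {b. omega1_less b a}" for a using countable_underS_omega1 by simp
    show "wf {(a, b). omega1_less a b}" by (fact wf_omega1_less)
    show "omega1_less a c" if "omega1_less a b" "omega1_less b c" for a b c
      using omega1_less_trans[OF that] .
    show "omega1_less a b \<or> a = b \<or> omega1_less b a" if "a \<in> Field omega1" "b \<in> Field omega1" for a b
      using omega1_less_total[OF that] .
    show "a \<in> Field omega1 \<and> b \<in> Field omega1" if "omega1_less a b" for a b
      using omega1_less_Field[OF that] .
  qed
  then show thesis using that by blast
qed

section \<open>Disjoint subsequences with common accumulation points\<close>

lemma in_closure_fun_iff:
  fixes p :: "'i \<Rightarrow> real"
  shows "p \<in> closure Y \<longleftrightarrow> (\<forall>S \<epsilon>. finite S \<longrightarrow> \<epsilon> > 0 \<longrightarrow> (\<exists>x\<in>Y. \<forall>r\<in>S. \<bar>x r - p r\<bar> < \<epsilon>))"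
proof
  assume p: "p \<in> closure Y"
  show "\<forall>S \<epsilon>. finite S \<longrightarrow> \<epsilon> > 0 \<longrightarrow> (\<exists>x\<in>Y. \<forall>r\<in>S. \<bar>x r - p r\<bar> < \<epsilon>)"
  proof (intro allI impI)
    fix S :: "'i set" and \<epsilon> :: real assume S: "finite S" "\<epsilon> > 0"
    let ?U = "\<Inter>r\<in>S. {x. \<bar>x r - p r\<bar> < \<epsilon>}"
    have "open {x. \<bar>x r - p r\<bar> < \<epsilon>}" for r
      by (intro open_Collect_less continuous_intros continuous_on_product_coordinates)
    then have "open ?U" using S(1) by blast
    moreover have "p \<in> ?U" using S(2) by simp
    ultimately have "?U \<inter> Y \<noteq> {}" using p closure_iff_nhds_not_empty by blast
    then show "\<exists>x\<in>Y. \<forall>r\<in>S. \<bar>x r - p r\<bar> < \<epsilon>" by blast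
  qed
next
  assume *: "\<forall>S \<epsilon>. finite S \<longrightarrow> \<epsilon> > 0 \<longrightarrow> (\<exists>x\<in>Y. \<forall>r\<in>S. \<bar>x r - p r\<bar> < \<epsilon>)"
  have "\<exists>x\<in>Y. x \<in> T" if T: "open T" "p \<in> T" for T
  proof -
    have "openin (product_topology (\<lambda>_. euclideanreal) UNIV) T"
      using T(1) by (simp add: euclidean_product_topology)
    then obtain U where U: "finite {i. U i \<noteq> (UNIV :: real set)}" "\<And>i. open (U i)" "p \<in> PiE UNIV U"
      "PiE UNIV U \<subseteq> T"
      using T(2) by (auto simp: openin_product_topology_alt)
    define S where "S = {i. U i \<noteq> UNIV}"
    have "\<exists>e>0. \<forall>y. \<bar>y - p i\<bar> < e \<longrightarrow> y \<in> U i" for i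
      using U(2)[of i] U(3) by (auto simp: open_dist dist_real_def PiE_iff)
    then obtain e where e: "\<And>i. e i > 0" "\<And>i y. \<bar>y - p i\<bar> < e i \<Longrightarrow> y \<in> U i" by metis
    define \<epsilon> where "\<epsilon> = Min (insert 1 (e ` S))"
    have fS: "finite S" using U(1) by (simp add: S_def)
    have "\<epsilon> > 0" using fS e(1) by (simp add: \<epsilon>_def)
    with * fS obtain x where x: "x \<in> Y" "\<forall>r\<in>S. \<bar>x r - p r\<bar> < \<epsilon>" by blast
    have "x i \<in> U i" for i
    proof (cases "i \<in> S")
      case True
      then have "\<epsilon> \<le> e i" using fS by (simp add: \<epsilon>_def)
      then show ?thesis using e(2) x(2) True by force
    qed (simp add: S_def)
    then have "x \<in> PiE UNIV U" by (simp add: PiE_iff)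
    then show ?thesis using U(4) x(1) by blast
  qed
  then show "p \<in> closure Y" by (auto simp: closure_iff_nhds_not_empty)
qed

lemma open_coordinate_vimage:
  fixes W :: "'b::topological_space set"
  shows "open W \<Longrightarrow> open ((\<lambda>h::'a \<Rightarrow> 'b. h i) -` W)"
  using continuous_on_product_coordinates by (intro open_vimage)

instance "fun" :: (type, t0_space) t0_space
proof
  fix f g :: "'a \<Rightarrow> 'b" assume "f \<noteq> g"
  then obtain i where i: "f i \<noteq> g i" by blast
  then obtain U where "open U" "\<not> (f i \<in> U \<longleftrightarrow> g i \<in> U)"
    using t0_space_class.t0_space[OF i] by blast
  then show "\<exists>U. open U \<and> \<not> (f \<in> U \<longleftrightarrow> g \<in> U)"
    by (intro exI[of _ "(\<lambda>h. h i) -` U"]) (simp add: open_coordinate_vimage)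
qed

instance "fun" :: (type, t1_space) t1_space
proof
  fix f g :: "'a \<Rightarrow> 'b" assume "f \<noteq> g"
  then obtain i where i: "f i \<noteq> g i" by blast
  then obtain U where "open U" "f i \<in> U" "g i \<notin> U"
    using t1_space_class.t1_space[OF i] by blast
  then show "\<exists>U. open U \<and> f \<in> U \<and> g \<notin> U"
    by (intro exI[of _ "(\<lambda>h. h i) -` U"]) (simp add: open_coordinate_vimage)
qed

instance "fun" :: (type, t2_space) t2_space
proof
  fix f g :: "'a \<Rightarrow> 'b" assume "f \<noteq> g"
  then obtain i where i: "f i \<noteq> g i" by blast
  then obtain U V where "open U" "open V" "f i \<in> U" "g i \<in> V" "U \<inter> V = {}"
    using hausdorff[OF i] by blast
  then show "\<exists>U V. open U \<and> open V \<and> f \<in> U \<and> g \<in> V \<and> U \<inter> V = {}"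
    by (intro exI[of _ "(\<lambda>h. h i) -` U"] exI[of _ "(\<lambda>h. h i) -` V"])
      (auto simp: open_coordinate_vimage)
qed

lemma finite_reciprocal_ge:
  fixes \<epsilon> :: real assumes "\<epsilon> > 0"
  shows "finite {n. \<epsilon> \<le> 1 / real (Suc n)}"
proof (rule finite_subset)
  show "{n. \<epsilon> \<le> 1 / real (Suc n)} \<subseteq> {..nat \<lfloor>1 / \<epsilon>\<rfloor>}"
  proof
    fix n assume "n \<in> {n. \<epsilon> \<le> 1 / real (Suc n)}"
    then have "real n \<le> 1 / \<epsilon>" using assms by (simp add: field_simps)
    then show "n \<in> {..nat \<lfloor>1 / \<epsilon>\<rfloor>}" by (simp add: le_nat_floor)
  qed
qed simp

definition accumulates :: "('i \<Rightarrow> real) \<Rightarrow> (nat \<Rightarrow> 'i \<Rightarrow> real) \<Rightarrow> nat set \<Rightarrow> bool" where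
  "accumulates p s A \<longleftrightarrow>
     (\<forall>S \<epsilon>. finite S \<longrightarrow> \<epsilon> > 0 \<longrightarrow> infinite {n\<in>A. \<forall>r\<in>S. \<bar>s n r - p r\<bar> < \<epsilon>})"

text \<open>Disjoint \<open>A\<close> and \<open>B\<close> with a common accumulation point are
  impossible in a copy of \<open>beta_nat\<close>, where disjoint sets of naturals have disjoint
  closures; a second such point rules out convergence.\<close>

definition branching :: "('i \<Rightarrow> real) set \<Rightarrow> bool" where
  "branching L \<longleftrightarrow> (\<forall>s. inj s \<longrightarrow> range s \<subseteq> L \<longrightarrow>
     (\<exists>A B p q. A \<inter> B = {} \<and> p \<in> L \<and> q \<in> L \<and> p \<noteq> q \<and>
        accumulates p s A \<and> accumulates p s B \<and> accumulates q s A \<and> accumulates q s B))"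

section \<open>Excluding convergent sequences and copies of \<open>beta_nat\<close>\<close>

lemma accumulates_imp_closure:
  fixes p :: "'a \<Rightarrow> real"
  shows "accumulates p s A \<Longrightarrow> p \<in> closure (s ` A)"
  unfolding in_closure_fun_iff
proof (intro allI impI)
  fix S :: "'a set" and \<epsilon> assume "accumulates p s A" "finite S" "\<epsilon> > (0::real)"
  then have "infinite {n\<in>A. \<forall>r\<in>S. \<bar>s n r - p r\<bar> < \<epsilon>}" by (simp add: accumulates_def)
  then have "{n\<in>A. \<forall>r\<in>S. \<bar>s n r - p r\<bar> < \<epsilon>} \<noteq> {}" by (rule infinite_imp_nonempty)
  then show "\<exists>x\<in>s ` A. \<forall>r\<in>S. \<bar>x r - p r\<bar> < \<epsilon>" by blast
qed

lemma accumulates_image: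
  fixes p :: "'a \<Rightarrow> real"
  assumes "inj k" "accumulates p (s \<circ> k) A"
  shows "accumulates p s (k ` A)"
  unfolding accumulates_def
proof (intro allI impI)
  fix S :: "'a set" and \<epsilon> assume "finite S" "\<epsilon> > (0::real)"
  then have "infinite {n\<in>A. \<forall>r\<in>S. \<bar>s (k n) r - p r\<bar> < \<epsilon>}"
    using assms(2) by (simp add: accumulates_def)
  moreover have "{n\<in>k ` A. \<forall>r\<in>S. \<bar>s n r - p r\<bar> < \<epsilon>} = k ` {n\<in>A. \<forall>r\<in>S. \<bar>s (k n) r - p r\<bar> < \<epsilon>}"
    by auto
  ultimately show "infinite {n\<in>k ` A. \<forall>r\<in>S. \<bar>s n r - p r\<bar> < \<epsilon>}"
    by (simp add: finite_image_iff inj_on_subset[OF assms(1) subset_UNIV])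
qed

lemma closure_image_convergent:
  fixes s :: "nat \<Rightarrow> 'a::t2_space"
  assumes "s \<longlonglongrightarrow> l"
  shows "closure (s ` A) \<subseteq> insert l (s ` A)"
proof
  fix y assume y: "y \<in> closure (s ` A)"
  show "y \<in> insert l (s ` A)"
  proof (rule ccontr)
    assume ny: "y \<notin> insert l (s ` A)"
    then obtain U V where UV: "open U" "open V" "y \<in> U" "l \<in> V" "U \<inter> V = {}"
      using hausdorff[of y l] by blast
    have "\<forall>\<^sub>F n in sequentially. s n \<in> V" using topological_tendstoD[OF assms UV(2,4)] .
    then obtain N where N: "\<And>n. n \<ge> N \<Longrightarrow> s n \<in> V" unfolding eventually_sequentially by blast
    let ?W = "U - s ` ({..<N} \<inter> A)"
    have "open ?W" using UV(1) by (intro open_Diff finite_imp_closed) auto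
    moreover have "y \<in> ?W" using UV(3) ny by auto
    ultimately have "?W \<inter> s ` A \<noteq> {}" using y open_Int_closure_eq_empty[of ?W "s ` A"] by blast
    then obtain n where "n \<in> A" "s n \<in> U" "s n \<notin> s ` ({..<N} \<inter> A)" by blast
    then show False using N[of n] UV(5) by (cases "n < N") auto
  qed
qed

text \<open>An injective sequence of terms still tends to \<open>l\<close>. A point in the closures
  of two disjoint sets of its terms can only be \<open>l\<close>, which would give
  \<open>p = q\<close>.\<close>

lemma branching_no_convergent_sequence:
  fixes C :: "('i \<Rightarrow> real) set"
  assumes "branching C"
  shows "\<not> has_nontrivial_convergent_sequence (top_of_set C)"
  unfolding has_nontrivial_convergent_sequence_def
proof (intro notI, elim exE conjE)
  fix x l assume x: "range x \<subseteq> topspace (top_of_set C)" "limitin (top_of_set C) x l sequentially"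
    and nc: "\<not> (\<exists>c. \<forall>\<^sub>F n in sequentially. x n = c)"
  have lim: "x \<longlonglongrightarrow> l" using x(2) by (simp add: limitin_subtopology)
  have inf: "infinite (range x)"
  proof
    assume "finite (range x)"
    then have "finite (range x - {l})" by simp
    then have "open (- (range x - {l}))" by (intro open_Compl finite_imp_closed)
    then have "\<forall>\<^sub>F n in sequentially. x n \<in> - (range x - {l})"
      by (rule topological_tendstoD[OF lim]) simp
    then have "\<forall>\<^sub>F n in sequentially. x n = l" by eventually_elim auto
    then show False using nc by blast
  qed
  then obtain g :: "nat \<Rightarrow> 'i \<Rightarrow> real" where g: "inj g" "range g \<subseteq> range x"
    using infinite_countable_subset by blast
  have "\<exists>m. x m = g n" for n using subsetD[OF g(2) rangeI[of g n]] by (auto simp: image_iff)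
  then obtain r where r: "\<And>n. x (r n) = g n" by metis
  have rinj: "inj r" by (rule injI) (metis g(1) injD r)
  have "filterlim r sequentially sequentially"
    unfolding filterlim_at_top
  proof
    fix m
    have "{n. \<not> m \<le> r n} = r -` {..<m}" by auto
    then have "\<forall>\<^sub>F n in cofinite. m \<le> r n"
      using finite_vimageI[OF finite_lessThan rinj] by (simp add: eventually_cofinite)
    then show "\<forall>\<^sub>F n in sequentially. m \<le> r n" by (simp add: cofinite_eq_sequentially)
  qed
  from filterlim_compose[OF lim this] have glim: "g \<longlonglongrightarrow> l" by (simp add: r)
  have "range g \<subseteq> C" using g(2) x(1) by auto
  then obtain A B p q where AB: "A \<inter> B = {}" "p \<noteq> q" "accumulates p g A" "accumulates p g B"
    "accumulates q g A" "accumulates q g B"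
    using assms g(1) unfolding branching_def by metis
  have "w = l" if "accumulates w g A" "accumulates w g B" for w
  proof -
    have "w \<in> insert l (g ` A)" "w \<in> insert l (g ` B)"
      using that accumulates_imp_closure closure_image_convergent[OF glim] by blast+
    then show ?thesis using AB(1) g(1) by (auto simp: inj_eq)
  qed
  then show False using AB by blast
qed

text \<open>The indicator function of \<open>A\<close> extends continuously to
  \<open>beta_nat\<close>, with value 1 on the closure of \<open>A\<close> and 0 on that of
  \<open>B\<close>, whereas an embedding would map a point of each closure to
  \<open>p\<close>.\<close>

lemma branching_no_beta_nat:
  fixes C :: "('i \<Rightarrow> real) set"
  assumes "branching C"
  shows "\<not> (\<exists>e. embedding_map beta_nat (top_of_set C) e)"
proof
  assume "\<exists>e. embedding_map beta_nat (top_of_set C) e"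
  then obtain e where emb: "embedding_map beta_nat (top_of_set C) e" by blast
  let ?N = "discrete_topology (UNIV :: nat set)"
  let ?F = "unit_functions ?N"
  let ?P = "product_topology (\<lambda>_. top_of_set {0..1::real}) ?F"
  let ?ev = "evaluation ?N"
  have beta: "beta_nat = subtopology ?P (?P closure_of range ?ev)"
    unfolding stone_cech_def Let_def by simp
  have F: "f \<in> ?F \<longleftrightarrow> range f \<subseteq> {0..1}" for f
    by (auto simp: unit_functions_def continuous_map_in_subtopology)
  have "compact_space (top_of_set {0..1::real})" by (simp add: compact_space_subtopology)
  then have "compact_space ?P" by (simp add: compact_space_product_topology)
  then have cb: "compact_space beta_nat"
    unfolding beta by (intro compact_space_subtopology closedin_compact_space) auto
  have evP: "?ev n \<in> topspace ?P" for n
    using F by (auto simp: evaluation_def)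
  have ev: "range ?ev \<subseteq> topspace beta_nat"
    unfolding beta using closure_of_subset[of "range ?ev" ?P] evP by auto
  have ce: "continuous_map beta_nat (top_of_set C) e" and ie: "inj_on e (topspace beta_nat)"
    using emb by (auto simp: embedding_map_def homeomorphic_eq_everything_map
        continuous_map_in_subtopology)
  have ind: "(\<lambda>n. of_bool (n \<in> A)) \<in> ?F" for A unfolding F by auto
  have evind: "?ev n (\<lambda>n. of_bool (n \<in> A)) = of_bool (n \<in> A)" for n A
    using ind[of A] by (simp add: evaluation_def)
  have iev: "inj ?ev"
  proof (rule injI)
    fix m n assume "?ev m = ?ev n"
    then show "m = n" using evind[of m "{m}"] evind[of n "{m}"] by (auto split: if_splits)
  qed
  define s where "s n = e (?ev n)" for n
  have "inj s"
  proof (rule injI)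
    fix m n assume "s m = s n"
    then have "?ev m = ?ev n" using ie ev unfolding s_def by (blast dest: inj_onD)
    then show "m = n" using iev by (simp add: inj_eq)
  qed
  moreover have "range s \<subseteq> C" using ce ev by (auto simp: s_def continuous_map_def)
  ultimately obtain A B p where AB: "A \<inter> B = {}" "accumulates p s A" "accumulates p s B"
    using assms unfolding branching_def by metis
  \<comment> \<open>The indicator is itself an index of the cube that contains
    \<open>beta_nat\<close>; its extension is evaluation at this index.\<close>
  let ?f = "(\<lambda>n. of_bool (n \<in> A)) :: nat \<Rightarrow> real"
  have cf: "continuous_map beta_nat euclideanreal (\<lambda>z. z ?f)"
  proof -
    have "continuous_map ?P (top_of_set {0..1}) (\<lambda>z. z ?f)"
      using ind by (rule continuous_map_product_projection)
    then show ?thesis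
      unfolding beta by (simp add: continuous_map_in_subtopology continuous_map_from_subtopology)
  qed
  \<comment> \<open>The points with value \<open>v\<close> form a compact set with closed image
    under \<open>e\<close>; containing \<open>s n\<close> for all \<open>n\<close> in
    \<open>D\<close>, the image contains \<open>p\<close>.\<close>
  have val: "\<exists>z \<in> topspace beta_nat. e z = p \<and> z ?f = v"
    if D: "accumulates p s D" "\<And>n. n \<in> D \<Longrightarrow> of_bool (n \<in> A) = v" for D v
  proof -
    let ?Y = "{z \<in> topspace beta_nat. z ?f \<in> {v}}"
    have "closedin beta_nat ?Y"
      by (rule closedin_continuous_map_preimage[OF cf]) simp
    then have "compactin beta_nat ?Y" using cb by (simp add: closedin_compact_space)
    then have "compactin (top_of_set C) (e ` ?Y)" using ce image_compactin by blast
    then have "compact (e ` ?Y)" by (simp add: compactin_subtopology)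
    then have "closed (e ` ?Y)" by (rule compact_imp_closed)
    moreover have "s ` D \<subseteq> e ` ?Y"
    proof (rule image_subsetI)
      fix n assume "n \<in> D"
      then have "?ev n \<in> ?Y" using ev D(2)[of n] evind[of n A] by auto
      then show "s n \<in> e ` ?Y" unfolding s_def by (rule imageI)
    qed
    ultimately have "closure (s ` D) \<subseteq> e ` ?Y" by (simp add: closure_minimal)
    then show ?thesis using accumulates_imp_closure[OF D(1)] by auto
  qed
  obtain z where z: "z \<in> topspace beta_nat" "e z = p" "z ?f = 1"
    using val[OF AB(2), of 1] by auto
  obtain z' where z': "z' \<in> topspace beta_nat" "e z' = p" "z' ?f = 0"
    using val[OF AB(3), of 0] AB(1) by auto
  have "z = z'" using z z' ie by (auto simp: inj_on_def)
  then show False using z z' by simp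
qed

lemma Hausdorff_space_euclidean_t2: "Hausdorff_space (euclidean :: 'a::t2_space topology)"
  unfolding Hausdorff_space_def disjnt_def using hausdorff by (metis open_openin)

lemma efimov_space_branching:
  fixes C :: "('i \<Rightarrow> real) set"
  assumes "compact C" "infinite C" "branching C"
  shows "efimov_space (top_of_set C)"
  unfolding efimov_space_def
  using assms branching_no_convergent_sequence[OF assms(3)] branching_no_beta_nat[OF assms(3)]
    Hausdorff_space_subtopology[OF Hausdorff_space_euclidean_t2]
  by (simp add: compact_space_subtopology)

text \<open>If infinitely many terms lie in \<open>L\<close>, the property of \<open>L\<close>
  applies to them. Otherwise infinitely many are attached points, which differ from distinct terms
  of \<open>d\<close> only at \<open>r0\<close>, by amounts tending to 0.\<close>

lemma branching_attach_sequence: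
  fixes L :: "('i \<Rightarrow> real) set" and r0 :: 'i
  assumes L: "branching L" "\<And>x. x \<in> L \<Longrightarrow> x r0 = 0" and d: "inj d" "range d \<subseteq> L"
  shows "branching (L \<union> range (\<lambda>n. (d n)(r0 := 1 / real (Suc n))))" (is "branching (L \<union> range ?D)")
  unfolding branching_def
proof (intro allI impI)
  let ?C = "L \<union> range ?D"
  fix s :: "nat \<Rightarrow> 'i \<Rightarrow> real" assume s: "inj s" "range s \<subseteq> ?C"
  have transfer: "\<exists>A B p q. A \<inter> B = {} \<and> p \<in> ?C \<and> q \<in> ?C \<and> p \<noteq> q \<and>
        accumulates p s A \<and> accumulates p s B \<and> accumulates q s A \<and> accumulates q s B"
    if u: "inj u" "range u \<subseteq> L" and k: "inj (k :: nat \<Rightarrow> nat)"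
      and acc: "\<And>p A. p \<in> L \<Longrightarrow> accumulates p u A \<Longrightarrow> accumulates p (s \<circ> k) A" for u k
  proof -
    obtain A B p q where AB: "A \<inter> B = {}" "p \<in> L" "q \<in> L" "p \<noteq> q" "accumulates p u A"
      "accumulates p u B" "accumulates q u A" "accumulates q u B"
      using L(1) u unfolding branching_def by metis
    have "accumulates w s (k ` D)" if "w \<in> L" "accumulates w u D" for w D
      using accumulates_image[OF k acc[OF that]] .
    moreover have "k ` A \<inter> k ` B = {}" using k AB(1) by (auto simp: inj_eq)
    ultimately show ?thesis
      by (intro exI[of _ "k ` A"] exI[of _ "k ` B"] exI[of _ p] exI[of _ q]) (simp add: AB)
  qed
  show "\<exists>A B p q. A \<inter> B = {} \<and> p \<in> ?C \<and> q \<in> ?C \<and> p \<noteq> q \<and>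
        accumulates p s A \<and> accumulates p s B \<and> accumulates q s A \<and> accumulates q s B"
  proof (cases "infinite {n. s n \<in> L}")
    case True
    then obtain k :: "nat \<Rightarrow> nat" where k: "inj k" "range k \<subseteq> {n. s n \<in> L}"
      using infinite_countable_subset by blast
    show ?thesis
      by (rule transfer[of "s \<circ> k" k]) (use k s in \<open>auto simp: inj_compose\<close>)
  next
    case False
    have "{n. s n \<notin> L} = - {n. s n \<in> L}" by auto
    then have "infinite {n. s n \<notin> L}" using False by (simp add: finite_compl)
    then obtain k :: "nat \<Rightarrow> nat" where k: "inj k" "range k \<subseteq> {n. s n \<notin> L}"
      using infinite_countable_subset by blast
    have "\<exists>i. s (k n) = ?D i" for n using k(2) s(2) by blast
    then obtain i where i: "\<And>n. s (k n) = ?D (i n)" by metis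
    have "inj i"
    proof (rule injI)
      fix m n assume "i m = i n"
      then have "s (k m) = s (k n)" using i by simp
      then show "m = n" using s(1) k(1) by (simp add: inj_eq)
    qed
    show ?thesis
    proof (rule transfer[of "d \<circ> i" k])
      show "inj (d \<circ> i)" using d(1) \<open>inj i\<close> by (rule inj_compose)
      fix p A assume p: "p \<in> L" and acc: "accumulates p (d \<circ> i) A"
      show "accumulates p (s \<circ> k) A"
        unfolding accumulates_def
      proof (intro allI impI)
        fix S :: "'i set" and \<epsilon> :: real assume S: "finite S" "\<epsilon> > 0"
        let ?N = "{n\<in>A. \<forall>r\<in>S. \<bar>(d \<circ> i) n r - p r\<bar> < \<epsilon>}"
        \<comment> \<open>Indices at which coordinate \<open>r0\<close> is not yet within
          \<open>\<epsilon>\<close> of 0, the value of \<open>p\<close> there; injectivity of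
          \<open>i\<close> makes them finitely many.\<close>
        let ?bad = "{n. \<epsilon> \<le> 1 / real (Suc (i n))}"
        have inf: "infinite ?N" using acc S by (simp add: accumulates_def)
        have "finite (i -` {m. \<epsilon> \<le> 1 / real (Suc m)})"
          using finite_reciprocal_ge[OF S(2)] \<open>inj i\<close> by (rule finite_vimageI)
        then have "infinite (?N - ?bad)" using inf by (simp add: vimage_def)
        moreover have "?N - ?bad \<subseteq> {n\<in>A. \<forall>r\<in>S. \<bar>(s \<circ> k) n r - p r\<bar> < \<epsilon>}"
          using L(2)[OF p] by (auto simp: i)
        ultimately show "infinite {n\<in>A. \<forall>r\<in>S. \<bar>(s \<circ> k) n r - p r\<bar> < \<epsilon>}"
          using finite_subset by blast
      qed
    qed (use d(2) k(1) in auto)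
  qed
qed

lemma continuous_on_reset_coordinate: "continuous_on UNIV (\<lambda>x::'i \<Rightarrow> real. x(r0 := c))"
proof (rule continuous_on_coordinatewise_then_product)
  show "continuous_on UNIV (\<lambda>x::'i \<Rightarrow> real. (x(r0 := c)) i)" for i
    by (cases "i = r0") (simp_all add: continuous_on_product_coordinates)
qed

text \<open>It suffices to prove closedness in the cube. A point \<open>p\<close> of the closure
  with \<open>p r0 = 0\<close> lies in \<open>L\<close>, because resetting \<open>r0\<close> is
  continuous and maps everything into the closed set \<open>L\<close>; otherwise only finitely many
  points of the space come close to \<open>p\<close>.\<close>

lemma compact_attach_sequence:
  fixes L :: "('i \<Rightarrow> real) set" and r0 :: 'i
  assumes L: "closed L" "L \<subseteq> PiE UNIV (\<lambda>_. {0..1})" "\<And>x. x \<in> L \<Longrightarrow> x r0 = 0"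
    and d: "range d \<subseteq> L"
  shows "compact (L \<union> range (\<lambda>n. (d n)(r0 := 1 / real (Suc n))))" (is "compact (L \<union> range ?D)")
proof -
  let ?C = "L \<union> range ?D"
  have "compactin (product_topology (\<lambda>_. euclideanreal) UNIV) (PiE UNIV (\<lambda>_::'i. {0..1::real}))"
    by (simp add: compactin_PiE)
  then have "compact (PiE UNIV (\<lambda>_::'i. {0..1::real}))"
    by (simp add: euclidean_product_topology)
  moreover have "?C \<subseteq> PiE UNIV (\<lambda>_::'i. {0..1::real})"
  proof -
    have "?D n \<in> PiE UNIV (\<lambda>_. {0..1})" for n
      using L(2) d by (auto simp: PiE_iff subset_iff)
    then show ?thesis using L(2) by blast
  qed
  moreover have "closed ?C"
  proof -
    have "p \<in> ?C" if p: "p \<in> closure ?C" for p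
    proof (cases "p r0 = 0")
      case True
      have reset: "x(r0 := 0) = x" if "x \<in> L" for x using L(3)[OF that] by auto
      have "(\<lambda>x. x(r0 := 0)) ` closure ?C \<subseteq> L"
      proof (rule image_closure_subset)
        show "continuous_on (closure ?C) (\<lambda>x. x(r0 := 0))"
          by (rule continuous_on_subset[OF continuous_on_reset_coordinate subset_UNIV])
        show "(\<lambda>x. x(r0 := 0)) ` ?C \<subseteq> L" using d reset by auto
      qed (fact L(1))
      then have "p(r0 := 0) \<in> L" using p by blast
      moreover have "p(r0 := 0) = p" using True by auto
      ultimately show ?thesis by simp
    next
      case False
      \<comment> \<open>A value within \<open>\<bar>p r0\<bar> / 2\<close> of \<open>p r0\<close> is
        bounded away from 0, which leaves finitely many \<open>n\<close> and no point of
        \<open>L\<close>.\<close>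
      define F where "F = {n. \<bar>1 / real (Suc n) - p r0\<bar> < \<bar>p r0\<bar> / 2}"
      have "F \<subseteq> {n. \<bar>p r0\<bar> / 2 \<le> 1 / real (Suc n)}"
      proof
        fix n assume n: "n \<in> F"
        define v where "v = 1 / real (Suc n)"
        have "\<bar>v - p r0\<bar> < \<bar>p r0\<bar> / 2" "v > 0" using n by (simp_all add: F_def v_def)
        then have "\<bar>p r0\<bar> / 2 \<le> v" by arith
        then show "n \<in> {n. \<bar>p r0\<bar> / 2 \<le> 1 / real (Suc n)}" by (simp add: v_def)
      qed
      then have "finite F"
        by (rule finite_subset) (rule finite_reciprocal_ge, use False in simp)
      then have cl: "closed (?D ` F)" by (intro finite_imp_closed finite_imageI)
      have "p \<in> closure (?D ` F)"
        unfolding in_closure_fun_iff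
      proof (intro allI impI)
        fix S :: "'i set" and \<epsilon> :: real assume S: "finite S" "\<epsilon> > 0"
        have "finite (insert r0 S)" "min \<epsilon> (\<bar>p r0\<bar> / 2) > 0" using S False by auto
        then obtain x where x: "x \<in> ?C" "\<forall>r\<in>insert r0 S. \<bar>x r - p r\<bar> < min \<epsilon> (\<bar>p r0\<bar> / 2)"
          using p[unfolded in_closure_fun_iff] by blast
        then have "\<bar>x r0 - p r0\<bar> < \<bar>p r0\<bar> / 2" by simp
        then have "x \<notin> L" using L(3) by fastforce
        then obtain n where n: "x = ?D n" using x(1) by blast
        then have "n \<in> F" using \<open>\<bar>x r0 - p r0\<bar> < \<bar>p r0\<bar> / 2\<close> by (simp add: F_def)
        then have "x \<in> ?D ` F" using n by blast
        moreover have "\<forall>r\<in>S. \<bar>x r - p r\<bar> < \<epsilon>" using x(2) by simp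
        ultimately show "\<exists>x\<in>?D ` F. \<forall>r\<in>S. \<bar>x r - p r\<bar> < \<epsilon>" by blast
      qed
      then show ?thesis using cl by auto
    qed
    then have "closure ?C \<subseteq> ?C" by blast
    then show ?thesis using closure_subset_eq by blast
  qed
  ultimately show ?thesis
    using compact_Int_closed[of "PiE UNIV (\<lambda>_. {0..1})" ?C] by (simp only: inf.absorb2)
qed

section \<open>Quotients from retractions\<close>

lemma vcarrier_Cp:
  "vcarrier (Cp X) = {f \<in> extensional (topspace X). continuous_map X euclideanreal f}"
  by (auto simp: Cp_def PiE_def)

lemma Cp_simps:
  "vzero (Cp X) = (\<lambda>x\<in>topspace X. 0)"
  "vadd (Cp X) f g = (\<lambda>x\<in>topspace X. f x + g x)"
  "vscale (Cp X) c f = (\<lambda>x\<in>topspace X. c * f x)"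
  by (simp_all add: Cp_def)

lemma continuous_map_restrict_topspace:
  "continuous_map X euclideanreal (\<lambda>x\<in>topspace X. f x) \<longleftrightarrow> continuous_map X euclideanreal f"
  by (rule iffI; erule continuous_map_eq; simp)

lemma continuous_map_Cp_coordinate:
  "x \<in> topspace X \<Longrightarrow> continuous_map (top_of (Cp X)) euclideanreal (\<lambda>f. f x)"
  using continuous_map_from_subtopology[OF continuous_map_product_projection[of x _ "\<lambda>_. euclideanreal"]]
  by (simp add: Cp_def)

text \<open>The lower bound \<open>N\<close> for the support is there for the induction: two functionals with disjoint
  supports have a nonzero combination that annihilates one more vector.\<close>

lemma ex_annihilator:
  fixes Y :: "(nat \<Rightarrow> real) set"
  assumes "finite Y"
  shows "\<exists>a M. (\<exists>j. a j \<noteq> 0) \<and> (\<forall>j. a j \<noteq> 0 \<longrightarrow> N \<le> j \<and> j < M) \<and>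
           (\<forall>y\<in>Y. (\<Sum>j<M. a j * y j) = 0)"
  using assms
proof (induction Y arbitrary: N rule: finite_induct)
  case empty
  show ?case
    by (rule exI[of _ "\<lambda>j. of_bool (j = N)"], rule exI[of _ "Suc N"]) auto
next
  case (insert y Y)
  obtain a M where a: "\<exists>j. a j \<noteq> 0" "\<forall>j. a j \<noteq> 0 \<longrightarrow> N \<le> j \<and> j < M"
    "\<forall>y\<in>Y. (\<Sum>j<M. a j * y j) = (0::real)"
    using insert.IH[of N] by blast
  obtain b M' where b: "\<exists>j. b j \<noteq> 0" "\<forall>j. b j \<noteq> 0 \<longrightarrow> max N M \<le> j \<and> j < M'"
    "\<forall>y\<in>Y. (\<Sum>j<M'. b j * y j) = (0::real)"
    using insert.IH[of "max N M"] by blast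
  have MM: "M \<le> M'" using b(1,2) by force
  have ext: "(\<Sum>j<M'. a j * z j) = (\<Sum>j<M. a j * z j)" for z :: "nat \<Rightarrow> real"
    by (rule sum.mono_neutral_right) (use MM a(2) in auto)
  define \<alpha> \<beta> where "\<alpha> = (\<Sum>j<M. a j * y j)" and "\<beta> = (\<Sum>j<M'. b j * y j)"
  show ?case
  proof (cases "\<alpha> = 0")
    case True
    then show ?thesis using a by (intro exI[of _ a] exI[of _ M]) (simp add: \<alpha>_def)
  next
    case False
    \<comment> \<open>The combination that annihilates \<open>y\<close> as well; it is nonzero
      because the supports are disjoint and \<open>\<alpha> \<noteq> 0\<close>.\<close>
    define c where "c j = \<alpha> * b j - \<beta> * a j" for j
    have sum_c: "(\<Sum>j<M'. c j * z j) = \<alpha> * (\<Sum>j<M'. b j * z j) - \<beta> * (\<Sum>j<M. a j * z j)"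
      for z :: "nat \<Rightarrow> real"
      unfolding ext[symmetric]
      by (simp add: c_def left_diff_distrib sum_subtractf sum_distrib_left mult.assoc)
    obtain j where j: "b j \<noteq> 0" using b(1) by blast
    then have "a j = 0" using a(2) b(2) by force
    then have "c j \<noteq> 0" using j False by (simp add: c_def)
    moreover have "N \<le> j \<and> j < M'" if "c j \<noteq> 0" for j
    proof -
      have "a j \<noteq> 0 \<or> b j \<noteq> 0" using that by (auto simp: c_def)
      then show ?thesis using a(2) b(2) MM by force
    qed
    moreover have "(\<Sum>j<M'. c j * z j) = 0" if "z \<in> insert y Y" for z
      unfolding sum_c using that a(3) b(3) by (auto simp: \<alpha>_def \<beta>_def)
    ultimately show ?thesis by (intro exI[of _ c] exI[of _ M']) auto
  qed
qed

text \<open>Countably many moved points make the quotient metrizable, infinitely many make it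
  infinite-dimensional, and their isolation provides continuous indicator functions.\<close>

locale retraction_with_countable_complement =
  fixes X :: "'a topology" and \<rho> :: "'a \<Rightarrow> 'a"
  assumes cont: "continuous_map X X \<rho>"
    and idem: "x \<in> topspace X \<Longrightarrow> \<rho> (\<rho> x) = \<rho> x"
    and countable_moved: "countable {x \<in> topspace X. \<rho> x \<noteq> x}"
    and infinite_moved: "infinite {x \<in> topspace X. \<rho> x \<noteq> x}"
    and isolated: "x \<in> topspace X \<Longrightarrow> \<rho> x \<noteq> x \<Longrightarrow> openin X {x} \<and> closedin X {x}"
begin

abbreviation "K \<equiv> topspace X"

definition "E = {x \<in> K. \<rho> x \<noteq> x}"

definition "Z = {f \<in> vcarrier (Cp X). \<forall>x\<in>K. f (\<rho> x) = f x}"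

definition defect :: "('a \<Rightarrow> real) \<Rightarrow> 'a \<Rightarrow> real" where
  "defect f = (\<lambda>x\<in>E. f x - f (\<rho> x))"

definition extend :: "('a \<Rightarrow> real) \<Rightarrow> 'a \<Rightarrow> real" where
  "extend h = (\<lambda>x\<in>K. if x \<in> E then h x else 0)"

section \<open>The subspace \<open>Z\<close> as the kernel of the defect map\<close>

lemma rho_K: "x \<in> K \<Longrightarrow> \<rho> x \<in> K"
  using cont by (auto simp: continuous_map_def)

lemma rho_E: "x \<in> E \<Longrightarrow> \<rho> x \<notin> E"
  by (auto simp: E_def idem)

lemma E_K: "E \<subseteq> K"
  by (auto simp: E_def)

lemma carrier_add: "f \<in> vcarrier (Cp X) \<Longrightarrow> g \<in> vcarrier (Cp X) \<Longrightarrow> vadd (Cp X) f g \<in> vcarrier (Cp X)"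
  by (auto simp: vcarrier_Cp Cp_simps continuous_map_restrict_topspace intro!: continuous_intros)

lemma carrier_scale: "f \<in> vcarrier (Cp X) \<Longrightarrow> vscale (Cp X) c f \<in> vcarrier (Cp X)"
  by (auto simp: vcarrier_Cp Cp_simps continuous_map_restrict_topspace intro!: continuous_intros)

lemma carrier_zero: "vzero (Cp X) \<in> vcarrier (Cp X)"
  by (auto simp: vcarrier_Cp Cp_simps continuous_map_restrict_topspace)

lemma linear_subspace_Z: "linear_subspace (Cp X) Z"
  unfolding linear_subspace_def
proof (intro conjI ballI allI)
  show "vzero (Cp X) \<in> Z"
    using carrier_zero by (auto simp: Z_def Cp_simps rho_K)
  show "vadd (Cp X) u v \<in> Z" if "u \<in> Z" "v \<in> Z" for u v
    using that carrier_add by (auto simp: Z_def Cp_simps rho_K)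
  show "vscale (Cp X) c u \<in> Z" if "u \<in> Z" for u c
    using that carrier_scale by (auto simp: Z_def Cp_simps rho_K)
qed (auto simp: Z_def)

lemma Z_iff_defect: "f \<in> vcarrier (Cp X) \<Longrightarrow> f \<in> Z \<longleftrightarrow> (\<forall>x\<in>E. defect f x = 0)"
  by (auto simp: Z_def defect_def E_def)

lemma continuous_map_defect:
  "continuous_map (top_of (Cp X)) (product_topology (\<lambda>_. euclideanreal) E) defect"
proof -
  have "continuous_map (top_of (Cp X)) euclideanreal (\<lambda>f. f x - f (\<rho> x))" if "x \<in> E" for x
    using that E_K rho_K by (intro continuous_intros continuous_map_Cp_coordinate) auto
  moreover have "continuous_map (top_of (Cp X)) euclideanreal (\<lambda>f. defect f x) =
      continuous_map (top_of (Cp X)) euclideanreal (\<lambda>f. f x - f (\<rho> x))" if "x \<in> E" for x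
    using that by (simp add: defect_def)
  ultimately show ?thesis
    unfolding continuous_map_componentwise by (auto simp: defect_def)
qed

lemma closedin_Z: "closedin (top_of (Cp X)) Z"
proof -
  let ?P = "product_topology (\<lambda>_. euclideanreal) E"
  have "Hausdorff_space ?P" by (simp add: Hausdorff_space_product_topology)
  then have "closedin ?P {\<lambda>x\<in>E. 0}"
    by (rule closedin_Hausdorff_singleton) auto
  from closedin_continuous_map_preimage[OF continuous_map_defect this]
  have "closedin (top_of (Cp X)) {f \<in> vcarrier (Cp X). defect f \<in> {\<lambda>x\<in>E. 0}}" .
  moreover have "{f \<in> vcarrier (Cp X). defect f \<in> {\<lambda>x\<in>E. 0}} = Z"
    using Z_iff_defect by (auto simp: defect_def restrict_def fun_eq_iff Z_def split: if_splits)
  ultimately show ?thesis by simp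
qed

text \<open>Since \<open>f - f \<circ> \<rho>\<close> vanishes off \<open>E\<close>, the extension
  by zero is this continuous function; its defect is that of \<open>f\<close> because
  \<open>\<rho>\<close> maps \<open>E\<close> out of \<open>E\<close>.\<close>

lemma extend_defect:
  assumes f: "f \<in> vcarrier (Cp X)"
  shows "extend (defect f) \<in> vcarrier (Cp X)" "defect (extend (defect f)) = defect f"
proof -
  have "extend (defect f) = (\<lambda>x\<in>K. f x - f (\<rho> x))"
    by (auto simp: extend_def defect_def E_def fun_eq_iff)
  moreover have "continuous_map X euclideanreal (f \<circ> \<rho>)"
    using f cont continuous_map_compose by (auto simp: vcarrier_Cp)
  then have "continuous_map X euclideanreal (\<lambda>x. f x - f (\<rho> x))"
    using f by (intro continuous_intros) (auto simp: vcarrier_Cp o_def)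
  ultimately show "extend (defect f) \<in> vcarrier (Cp X)"
    by (simp add: vcarrier_Cp continuous_map_restrict_topspace)
  show "defect (extend (defect f)) = defect f"
    using E_K rho_K rho_E by (auto simp: extend_def defect_def fun_eq_iff)
qed

lemma coset_eq_iff:
  assumes u: "u \<in> vcarrier (Cp X)" and v: "v \<in> vcarrier (Cp X)"
  shows "coset (Cp X) Z u = coset (Cp X) Z v \<longleftrightarrow> defect u = defect v"
proof
  assume "coset (Cp X) Z u = coset (Cp X) Z v"
  moreover have "u = vadd (Cp X) u (vzero (Cp X))"
    using u by (auto simp: Cp_simps vcarrier_Cp extensional_def fun_eq_iff)
  then have "u \<in> coset (Cp X) Z u"
    using linear_subspace_Z by (auto simp: coset_def linear_subspace_def)
  ultimately obtain z where "z \<in> Z" "u = vadd (Cp X) v z"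
    by (auto simp: coset_def)
  then show "defect u = defect v"
    using E_K rho_K by (auto simp: Z_def defect_def Cp_simps fun_eq_iff)
next
  have sub: "coset (Cp X) Z u \<subseteq> coset (Cp X) Z v"
    if u: "u \<in> vcarrier (Cp X)" and v: "v \<in> vcarrier (Cp X)" and d: "defect u = defect v" for u v
  proof
    fix w assume "w \<in> coset (Cp X) Z u"
    then obtain z where z: "z \<in> Z" "w = vadd (Cp X) u z" by (auto simp: coset_def)
    let ?d = "vadd (Cp X) u (vscale (Cp X) (-1) v)"
    have dc: "?d \<in> vcarrier (Cp X)" using u v carrier_add carrier_scale by blast
    have "defect ?d x = 0" if "x \<in> E" for x
    proof -
      have "defect u x = defect v x" using d by simp
      then show ?thesis using that E_K rho_K by (auto simp: defect_def Cp_simps)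
    qed
    then have "?d \<in> Z" using Z_iff_defect[OF dc] by blast
    then have "vadd (Cp X) ?d z \<in> Z" using z linear_subspace_Z by (auto simp: linear_subspace_def)
    moreover have "w = vadd (Cp X) v (vadd (Cp X) ?d z)"
      using z(2) by (auto simp: Cp_simps fun_eq_iff)
    ultimately show "w \<in> coset (Cp X) Z v" by (auto simp: coset_def)
  qed
  assume "defect u = defect v"
  then show "coset (Cp X) Z u = coset (Cp X) Z v" using sub u v by (intro equalityI) auto
qed

text \<open>The map induced by \<open>defect\<close> on the quotient, well defined by
  \<open>coset_eq_iff\<close>.\<close>

definition coset_defect :: "('a \<Rightarrow> real) set \<Rightarrow> 'a \<Rightarrow> real" where
  "coset_defect A = defect (SOME u. u \<in> vcarrier (Cp X) \<and> coset (Cp X) Z u = A)"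

lemma coset_defect:
  assumes "u \<in> vcarrier (Cp X)"
  shows "coset_defect (coset (Cp X) Z u) = defect u"
proof -
  have "\<exists>v. v \<in> vcarrier (Cp X) \<and> coset (Cp X) Z v = coset (Cp X) Z u" using assms by blast
  from someI_ex[OF this] show ?thesis
    unfolding coset_defect_def using coset_eq_iff assms by blast
qed

lemma topspace_coset_topology: "topspace (coset_topology (Cp X) Z) = coset (Cp X) Z ` vcarrier (Cp X)"
  using quotient_imp_surjective_map[OF quotient_map_coset] by metis

text \<open>The quotient is homeomorphic to the range of \<open>defect\<close> inside a countable
  power of the reals: the induced map is continuous by the quotient property, and its inverse
  factors through the continuous map \<open>extend\<close>.\<close>

lemma metrizable_quotient: "metrizable_space (coset_topology (Cp X) Z)"
proof -
  let ?P = "product_topology (\<lambda>_. euclideanreal) E"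
  let ?M = "defect ` vcarrier (Cp X)"
  let ?S = "subtopology ?P ?M"
  have "countable {i \<in> E. Q i}" for Q
    using countable_moved by (rule countable_subset[rotated]) (auto simp: E_def)
  then have "metrizable_space ?P"
    by (simp add: metrizable_space_product_topology metrizable_space_euclidean)
  then have "metrizable_space ?S" by (rule metrizable_space_subtopology)
  moreover have "?S homeomorphic_space coset_topology (Cp X) Z"
    unfolding homeomorphic_space_def
  proof (intro exI)
    have top: "topspace ?S = ?M" by (auto simp: defect_def)
    have "continuous_map ?S (product_topology (\<lambda>_. euclideanreal) K) extend"
    proof -
      have "continuous_map ?S euclideanreal (\<lambda>h. extend h x)" if "x \<in> K" for x
        using that by (cases "x \<in> E") (auto simp: extend_def intro: continuous_map_from_subtopology continuous_map_product_projection)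
      then show ?thesis
        unfolding continuous_map_componentwise by (auto simp: extend_def)
    qed
    then have "continuous_map ?S (top_of (Cp X)) extend"
      using extend_defect(1) by (auto simp: Cp_def continuous_map_in_subtopology vcarrier_Cp)
    then have "continuous_map ?S (coset_topology (Cp X) Z) (coset (Cp X) Z \<circ> extend)"
      using quotient_imp_continuous_map[OF quotient_map_coset] continuous_map_compose by blast
    moreover have "continuous_map (coset_topology (Cp X) Z) ?S coset_defect"
    proof (rule continuous_compose_quotient_map[OF quotient_map_coset])
      have "continuous_map (top_of (Cp X)) ?S defect"
        using continuous_map_defect by (simp add: continuous_map_in_subtopology)
      then show "continuous_map (top_of (Cp X)) ?S (coset_defect \<circ> coset (Cp X) Z)"
        by (rule continuous_map_eq) (simp add: coset_defect)
    qed
    ultimately show "homeomorphic_maps ?S (coset_topology (Cp X) Z) (coset (Cp X) Z \<circ> extend) coset_defect"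
      unfolding homeomorphic_maps_def top topspace_coset_topology
      using extend_defect coset_defect coset_eq_iff by auto
  qed
  ultimately show ?thesis using homeomorphic_metrizable_space by blast
qed

text \<open>A nonzero functional with finite support annihilates the defects of finitely many cosets
  along \<open>e\<close>. If these cosets spanned, it would vanish on the whole quotient, but it
  does not vanish at the indicator of a suitable point \<open>e i\<close>.\<close>

lemma infinite_dimensional_quotient: "infinite_dimensional (quotient_tvs (Cp X) Z)"
  unfolding infinite_dimensional_def
proof
  let ?Q = "quotient_tvs (Cp X) Z"
  have carrier: "vcarrier ?Q = coset (Cp X) Z ` vcarrier (Cp X)"
    by (simp add: quotient_tvs_def topspace_coset_topology)
  assume "\<exists>B. finite B \<and> B \<subseteq> vcarrier ?Q \<and> linear_span ?Q B = vcarrier ?Q"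
  then obtain B where B: "finite B" "B \<subseteq> vcarrier ?Q" "linear_span ?Q B = vcarrier ?Q" by blast
  obtain e :: "nat \<Rightarrow> 'a" where e: "inj e" "range e \<subseteq> E"
    using infinite_countable_subset[OF infinite_moved] by (auto simp: E_def)
  have "finite ((\<lambda>A j. coset_defect A (e j)) ` B)" using B(1) by simp
  from ex_annihilator[OF this, of 0] obtain a M where
    a: "\<exists>j. a j \<noteq> 0" "\<forall>j. a j \<noteq> 0 \<longrightarrow> j < M" and
    ann: "\<forall>A\<in>B. (\<Sum>j<M. a j * coset_defect A (e j)) = 0" by auto
  define W where "W = {A \<in> vcarrier ?Q. (\<Sum>j<M. a j * coset_defect A (e j)) = 0}"
  have coset_add: "vadd ?Q (coset (Cp X) Z u) (coset (Cp X) Z v) = coset (Cp X) Z (vadd (Cp X) u v)"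
    (is "?L = ?R") for u v
  proof
    have "vadd (Cp X) (vadd (Cp X) u z) (vadd (Cp X) v z') =
        vadd (Cp X) (vadd (Cp X) u v) (vadd (Cp X) z z')" for z z'
      by (auto simp: Cp_simps fun_eq_iff)
    then show "?L \<subseteq> ?R"
      using linear_subspace_Z by (auto simp: quotient_tvs_def coset_def linear_subspace_def)
    have "vadd (Cp X) (vadd (Cp X) u v) z =
        vadd (Cp X) (vadd (Cp X) u z) (vadd (Cp X) v (vzero (Cp X)))" for z
      by (auto simp: Cp_simps fun_eq_iff)
    then show "?R \<subseteq> ?L"
      using linear_subspace_Z by (auto simp: quotient_tvs_def coset_def linear_subspace_def)
  qed
  have coset_scale: "vscale ?Q c (coset (Cp X) Z u) = coset (Cp X) Z (vscale (Cp X) c u)"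
    (is "?L = ?R") for c u
  proof
    have "vadd (Cp X) (vscale (Cp X) c (vadd (Cp X) u z)) z' =
        vadd (Cp X) (vscale (Cp X) c u) (vadd (Cp X) (vscale (Cp X) c z) z')" for z z'
      by (auto simp: Cp_simps fun_eq_iff algebra_simps)
    then show "?L \<subseteq> ?R"
      using linear_subspace_Z by (auto simp: quotient_tvs_def coset_def linear_subspace_def)
    have "vadd (Cp X) (vscale (Cp X) c u) z =
        vadd (Cp X) (vscale (Cp X) c (vadd (Cp X) u (vzero (Cp X)))) z" for z
      by (auto simp: Cp_simps fun_eq_iff)
    then show "?R \<subseteq> ?L"
      using linear_subspace_Z by (auto simp: quotient_tvs_def coset_def linear_subspace_def)
  qed
  have coset_zero: "vzero ?Q = coset (Cp X) Z (vzero (Cp X))"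
  proof -
    have "vadd (Cp X) (vzero (Cp X)) z = z" if "z \<in> Z" for z
      using that by (auto simp: Z_def vcarrier_Cp Cp_simps extensional_def fun_eq_iff)
    then show ?thesis by (simp add: quotient_tvs_def coset_def)
  qed
  have eE: "e j \<in> E" "e j \<in> K" "\<rho> (e j) \<in> K" for j using e(2) E_K rho_K by blast+
  have defect_add: "defect (vadd (Cp X) u v) (e j) = defect u (e j) + defect v (e j)" for u v j
    using eE by (simp add: defect_def Cp_simps)
  have defect_scale: "defect (vscale (Cp X) c u) (e j) = c * defect u (e j)" for u c j
    using eE by (simp add: defect_def Cp_simps algebra_simps)
  have defect_zero: "defect (vzero (Cp X)) (e j) = 0" for j
    using eE by (simp add: defect_def Cp_simps)
  have "linear_subspace ?Q W"
    unfolding linear_subspace_def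
  proof (intro conjI ballI allI)
    show "vzero ?Q \<in> W"
      using carrier_zero by (simp add: W_def coset_zero carrier coset_defect defect_zero)
  next
    fix A A' assume "A \<in> W" "A' \<in> W"
    then obtain u v where "A = coset (Cp X) Z u" "u \<in> vcarrier (Cp X)"
      "A' = coset (Cp X) Z v" "v \<in> vcarrier (Cp X)"
      "(\<Sum>j<M. a j * defect u (e j)) = 0" "(\<Sum>j<M. a j * defect v (e j)) = 0"
      unfolding W_def carrier using coset_defect by auto
    then show "vadd ?Q A A' \<in> W"
      using carrier_add[of u v]
      by (simp add: W_def carrier coset_add coset_defect defect_add distrib_left sum.distrib)
  next
    fix c A assume "A \<in> W"
    then obtain u where "A = coset (Cp X) Z u" "u \<in> vcarrier (Cp X)"
      "(\<Sum>j<M. a j * defect u (e j)) = 0"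
      unfolding W_def carrier using coset_defect by auto
    then show "vscale ?Q c A \<in> W"
      using carrier_scale[of u c]
      by (simp add: W_def carrier coset_scale coset_defect defect_scale mult.left_commute
          flip: sum_distrib_left)
  qed (auto simp: W_def)
  moreover have "B \<subseteq> W" using B(2) ann by (auto simp: W_def)
  ultimately have "vcarrier ?Q \<subseteq> W"
    unfolding B(3)[symmetric] linear_span_def by (simp add: hull_minimal)
  obtain i where i: "a i \<noteq> 0" using a(1) by blast
  \<comment> \<open>The indicator of the isolated point \<open>e i\<close>; its defect along
    \<open>e\<close> is the unit vector at \<open>i\<close>, as \<open>\<rho>\<close> moves points
    of \<open>E\<close> out of \<open>E\<close>.\<close>
  define u where "u = (\<lambda>x\<in>K. if x = e i then 1 else 0 :: real)"
  have "continuous_map X euclideanreal (\<lambda>x. if x = e i then 1 else 0 :: real)"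
    unfolding continuous_map_def
  proof (intro conjI allI impI)
    fix U :: "real set"
    let ?V = "{x \<in> K. (if x = e i then 1 else 0) \<in> U}"
    have "openin X {e i}" "openin X (K - {e i})"
      using isolated[of "e i"] eE[of i] by (auto simp: E_def)
    moreover have "?V = {} \<or> ?V = {e i} \<or> ?V = K - {e i} \<or> ?V = K"
      using eE[of i] by (cases "(0::real) \<in> U"; cases "(1::real) \<in> U") auto
    ultimately show "openin X ?V"
      by (elim disjE) (simp_all only: openin_empty openin_topspace)
  qed auto
  then have u: "u \<in> vcarrier (Cp X)"
    unfolding u_def vcarrier_Cp by (simp add: continuous_map_restrict_topspace)
  then have "coset (Cp X) Z u \<in> W" using \<open>vcarrier ?Q \<subseteq> W\<close> carrier by blast
  then have "(\<Sum>j<M. a j * defect u (e j)) = 0" by (simp add: W_def coset_defect[OF u])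
  moreover have "defect u (e j) = of_bool (j = i)" for j
  proof -
    have "\<rho> (e j) \<noteq> e i" using rho_E[OF eE(1)[of j]] eE(1)[of i] by metis
    then show ?thesis using eE e(1) by (auto simp: defect_def u_def inj_eq)
  qed
  ultimately show False using i a(2) by simp
qed

lemma metrizable_infinite_dimensional_quotient:
  "linear_subspace (Cp X) Z \<and> closedin (top_of (Cp X)) Z \<and>
   metrizable_space (top_of (quotient_tvs (Cp X) Z)) \<and> infinite_dimensional (quotient_tvs (Cp X) Z)"
  using linear_subspace_Z closedin_Z metrizable_quotient infinite_dimensional_quotient
  by (simp add: quotient_tvs_def)

end

section \<open>The Efimov space\<close>

text \<open>The space from \<open>ex_fedorchuk\<close> is moved from coordinates in
  \<open>nat set\<close> to real coordinates, one of which stays constantly 0 for the attachment of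
  isolated points.\<close>

lemma ex_compact_branching:
  assumes diamond
  obtains L :: "(real \<Rightarrow> real) set" and r0 where
    "closed L" "L \<subseteq> PiE UNIV (\<lambda>_. {0..1})" "\<And>x. x \<in> L \<Longrightarrow> x r0 = 0" "infinite L" "branching L"
proof -
  obtain t where "guessing omega1_less (Field omega1) t"
    using guessing_omega1[OF assms] by blast
  then interpret guessing omega1_less "Field omega1" t .
  obtain L0 :: "(nat set \<Rightarrow> bool) set" where inf: "infinite L0"
    and cl: "\<forall>x. (\<forall>S. finite S \<longrightarrow> (\<exists>y\<in>L0. \<forall>c\<in>S. y c = x c)) \<longrightarrow> x \<in> L0"
    and br: "\<forall>s. inj s \<longrightarrow> range s \<subseteq> L0 \<longrightarrow>
       (\<exists>A B p q. A \<inter> B = {} \<and> p \<in> L0 \<and> q \<in> L0 \<and> p \<noteq> q \<and>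
         clusters p s A \<and> clusters p s B \<and> clusters q s A \<and> clusters q s B)"
    using ex_fedorchuk by (elim exE conjE)
  obtain g :: "nat set \<Rightarrow> real" where "bij g"
    using nat_sets_eqpoll_reals by (auto simp: eqpoll_def)
  \<comment> \<open>The exponential keeps \<open>j\<close> injective and off 0, which leaves
    coordinate 0 vacant.\<close>
  define j where "j c = exp (g c)" for c
  have j: "inj j" using bij_is_inj[OF \<open>bij g\<close>] by (auto simp: j_def inj_def)
  have j0: "j c \<noteq> 0" for c by (simp add: j_def)
  define emb :: "(nat set \<Rightarrow> bool) \<Rightarrow> real \<Rightarrow> real" where
    "emb x r = of_bool (\<exists>c. j c = r \<and> x c)" for x r
  have emb_j: "emb x (j c) = of_bool (x c)" for x c
    using j by (auto simp: emb_def inj_eq)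
  have emb_0: "emb x r = 0" if "r \<notin> range j" for x r
    using that by (auto simp: emb_def)
  have emb_01: "0 \<le> emb x r \<and> emb x r \<le> 1" for x r by (simp add: emb_def)
  have inj_emb: "inj emb"
  proof (rule injI)
    fix x y assume "emb x = emb y"
    then have "emb x (j c) = emb y (j c)" for c by simp
    then have "x c = y c" for c unfolding emb_j of_bool_eq_iff .
    then show "x = y" by blast
  qed
  have emb_close: "emb x r = emb y r" if "\<And>c. j c = r \<Longrightarrow> x c = y c" for x y r
    using that by (auto simp: emb_def)
  have acc: "accumulates (emb p) (emb \<circ> s) A" if "clusters p s A" for p s A
    unfolding accumulates_def
  proof (intro allI impI)
    fix S :: "real set" and \<epsilon> :: real assume S: "finite S" "\<epsilon> > 0"
    have "finite (j -` S)" using S(1) j by (rule finite_vimageI)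
    then have "infinite {n \<in> A. \<forall>c\<in>j -` S. s n c = p c}" using that by (simp add: clusters_def)
    moreover have "{n \<in> A. \<forall>c\<in>j -` S. s n c = p c} \<subseteq> {n \<in> A. \<forall>r\<in>S. \<bar>(emb \<circ> s) n r - emb p r\<bar> < \<epsilon>}"
    proof clarify
      fix n r assume "\<forall>c\<in>j -` S. s n c = p c" "r \<in> S"
      then have "emb (s n) r = emb p r" by (intro emb_close) auto
      then show "\<bar>(emb \<circ> s) n r - emb p r\<bar> < \<epsilon>" using S(2) by simp
    qed
    ultimately show "infinite {n \<in> A. \<forall>r\<in>S. \<bar>(emb \<circ> s) n r - emb p r\<bar> < \<epsilon>}"
      using finite_subset by blast
  qed
  show thesis
  proof (rule that[of "emb ` L0" 0])
    show "emb ` L0 \<subseteq> PiE UNIV (\<lambda>_. {0..1})" using emb_01 by auto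
    show "x 0 = 0" if "x \<in> emb ` L0" for x
      using that emb_0[of 0] j0 by (metis imageE)
    show "infinite (emb ` L0)"
      using inf by (simp add: finite_image_iff inj_on_subset[OF inj_emb subset_UNIV])
    show "branching (emb ` L0)"
      unfolding branching_def
    proof (intro allI impI)
      fix s :: "nat \<Rightarrow> real \<Rightarrow> real" assume s: "inj s" "range s \<subseteq> emb ` L0"
      have "\<exists>x\<in>L0. s n = emb x" for n using s(2) by blast
      then obtain s0 where s0: "\<And>n. s0 n \<in> L0" "\<And>n. s n = emb (s0 n)" by metis
      have "inj s0" using s(1) s0(2) by (auto simp: inj_def)
      moreover have "range s0 \<subseteq> L0" using s0(1) by blast
      ultimately have "\<exists>A B p q. A \<inter> B = {} \<and> p \<in> L0 \<and> q \<in> L0 \<and> p \<noteq> q \<and>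
         clusters p s0 A \<and> clusters p s0 B \<and> clusters q s0 A \<and> clusters q s0 B"
        using br by blast
      then obtain A B p q where AB: "A \<inter> B = {}" "p \<in> L0" "q \<in> L0" "p \<noteq> q"
        "clusters p s0 A" "clusters p s0 B" "clusters q s0 A" "clusters q s0 B"
        by (elim exE conjE)
      have "s = emb \<circ> s0" using s0(2) by auto
      then show "\<exists>A B p q. A \<inter> B = {} \<and> p \<in> emb ` L0 \<and> q \<in> emb ` L0 \<and> p \<noteq> q \<and>
          accumulates p s A \<and> accumulates p s B \<and> accumulates q s A \<and> accumulates q s B"
        using AB acc by (intro exI[of _ A] exI[of _ B] exI[of _ "emb p"] exI[of _ "emb q"])
          (simp add: inj_eq[OF inj_emb])
    qed
    have "y \<in> emb ` L0" if y: "y \<in> closure (emb ` L0)" for y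
    proof -
      define x where "x c \<longleftrightarrow> y (j c) > 1/2" for c
      have near: "\<exists>x'\<in>L0. (\<forall>c\<in>S. x' c = x c) \<and> (\<forall>r\<in>R. \<bar>emb x' r - y r\<bar> < \<epsilon>)"
        if "finite S" "finite R" "\<epsilon> > 0" for S R \<epsilon>
      proof -
        have "finite (j ` S \<union> R)" "min \<epsilon> (1/2) > 0" using that by auto
        then obtain z where z: "z \<in> emb ` L0" "\<forall>r\<in>j ` S \<union> R. \<bar>z r - y r\<bar> < min \<epsilon> (1/2)"
          using y[unfolded in_closure_fun_iff] by blast
        obtain x' where x': "x' \<in> L0" "z = emb x'" using z(1) by blast
        have "x' c = x c" if "c \<in> S" for c
        proof -
          have "\<bar>of_bool (x' c) - y (j c)\<bar> < 1/2" using z(2) that x'(2) emb_j[of x' c] by force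
          then show ?thesis by (cases "x' c") (auto simp: x_def abs_if split: if_splits)
        qed
        then show ?thesis using x' z(2) by (intro bexI[of _ x']) auto
      qed
      have "x \<in> L0"
      proof (rule cl[rule_format])
        show "\<exists>x'\<in>L0. \<forall>c\<in>S. x' c = x c" if "finite S" for S
          using near[OF that finite.emptyI, of 1] by auto
      qed
      moreover have "y r = emb x r" for r
      proof (rule ccontr)
        assume ne: "y r \<noteq> emb x r"
        have "finite (j -` {r})" using j by (intro finite_vimageI) simp_all
        \<comment> \<open>With the distance itself as tolerance, an \<open>x'\<close> that equals
          \<open>x\<close> at the coordinate over \<open>r\<close> would be closer to
          \<open>y r\<close> than \<open>emb x r\<close> is.\<close>
        from near[OF this, of "{r}" "\<bar>emb x r - y r\<bar>"] ne obtain x' where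
          x': "\<forall>c\<in>j -` {r}. x' c = x c" "\<bar>emb x' r - y r\<bar> < \<bar>emb x r - y r\<bar>" by auto
        have "emb x' r = emb x r" using x'(1) by (intro emb_close) auto
        then show False using x'(2) by simp
      qed
      then have "y = emb x" by auto
      ultimately show ?thesis by blast
    qed
    then have "closure (emb ` L0) \<subseteq> emb ` L0" by blast
    then show "closed (emb ` L0)" using closure_subset_eq by blast
  qed
qed

theorem mainTheorem3:
  assumes "diamond"
  shows "\<exists>K :: (real \<Rightarrow> real) topology.
           efimov_space K \<and>
           (\<exists>Z. linear_subspace (Cp K) Z \<and> closedin (top_of (Cp K)) Z \<and>
              metrizable_space (top_of (quotient_tvs (Cp K) Z)) \<and>
              infinite_dimensional (quotient_tvs (Cp K) Z))"
proof -
  obtain L :: "(real \<Rightarrow> real) set" and r0 where L: "closed L" "L \<subseteq> PiE UNIV (\<lambda>_. {0..1})"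
    "\<And>x. x \<in> L \<Longrightarrow> x r0 = 0" "infinite L" "branching L"
    using ex_compact_branching[OF assms] by metis
  obtain d :: "nat \<Rightarrow> real \<Rightarrow> real" where d: "inj d" "range d \<subseteq> L"
    using infinite_countable_subset[OF L(4)] by blast
  define D where "D n = (d n)(r0 := 1 / real (Suc n))" for n
  define C where "C = L \<union> range D"
  have "compact C" "infinite C" "branching C"
    unfolding C_def D_def
    using compact_attach_sequence[OF L(1-3) d(2)] L(4) branching_attach_sequence[OF L(5,3) d] by auto
  then have ef: "efimov_space (top_of_set C)" by (rule efimov_space_branching)
  \<comment> \<open>Resetting \<open>r0\<close> fixes \<open>L\<close> and sends \<open>D n\<close>
    to \<open>d n\<close>, so it retracts the space onto \<open>L\<close>.\<close>
  define \<rho> where "\<rho> x = x(r0 := 0)" for x :: "real \<Rightarrow> real"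
  have rL: "\<rho> x = x" if "x \<in> L" for x using L(3)[OF that] by (auto simp: \<rho>_def)
  have rD: "\<rho> (D n) = d n" for n
    using L(3)[of "d n"] d(2) by (auto simp: \<rho>_def D_def fun_eq_iff)
  have Dr0: "D n r0 = 1 / real (Suc n)" for n by (simp add: D_def)
  have DL: "D n \<notin> L" for n using L(3)[of "D n"] Dr0[of n] by auto
  have moved: "{x \<in> C. \<rho> x \<noteq> x} = range D"
    using rL rD DL d(2) by (auto simp: C_def)
  have "inj D"
  proof (rule injI)
    fix m n assume "D m = D n"
    then have "\<rho> (D m) = \<rho> (D n)" by simp
    then show "m = n" using d(1) by (simp add: rD inj_eq)
  qed
  interpret retraction_with_countable_complement "top_of_set C" \<rho>
  proof
    have "continuous_on C \<rho>"
      unfolding \<rho>_def using continuous_on_reset_coordinate by (rule continuous_on_subset) simp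
    moreover have "\<rho> ` C \<subseteq> C" using rL rD d(2) by (auto simp: C_def)
    ultimately show "continuous_map (top_of_set C) (top_of_set C) \<rho>"
      by (simp add: image_subset_iff_funcset)
    show "\<rho> (\<rho> x) = \<rho> x" for x by (simp add: \<rho>_def)
    show "countable {x \<in> topspace (top_of_set C). \<rho> x \<noteq> x}" using moved by simp
    show "infinite {x \<in> topspace (top_of_set C). \<rho> x \<noteq> x}"
      using moved range_inj_infinite[OF \<open>inj D\<close>] by simp
    fix x assume "x \<in> topspace (top_of_set C)" "\<rho> x \<noteq> x"
    then obtain n where x: "x = D n" using moved by auto
    \<comment> \<open>The strict bound, which is the \<open>r0\<close> coordinate of
      \<open>D (Suc n)\<close>, excludes \<open>L\<close> and all later attached points; the
      finitely many earlier ones are removed.\<close>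
    let ?U = "{y :: real \<Rightarrow> real. 1 / real (Suc (Suc n)) < y r0} \<inter>
        - D ` {..<n}"
    have "open ?U"
      by (intro open_Int open_Collect_less continuous_intros continuous_on_product_coordinates
          open_Compl finite_imp_closed) auto
    moreover have "C \<inter> ?U = {x}"
    proof -
      have "y = D n" if yC: "y \<in> C" and yU: "y \<in> ?U" for y
      proof -
        have big: "1 / real (Suc (Suc n)) < y r0" using yU by simp
        moreover have "0 < 1 / real (Suc (Suc n))" by simp
        ultimately have "y r0 \<noteq> 0" by linarith
        then have "y \<notin> L" using L(3) by blast
        then obtain m where m: "y = D m" using yC unfolding C_def by blast
        have "m < Suc n"
        proof (rule ccontr)
          assume "\<not> m < Suc n"
          then have "1 / real (Suc m) \<le> 1 / real (Suc (Suc n))" by (intro divide_left_mono) auto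
          then show False using big unfolding m Dr0 by linarith
        qed
        moreover have "\<not> m < n" using yU m by auto
        ultimately have "m = n" by simp
        then show ?thesis using m by simp
      qed
      moreover have "x \<in> C \<inter> ?U"
        using \<open>inj D\<close> by (auto simp: x C_def Dr0 inj_eq frac_less2)
      ultimately show ?thesis using x by blast
    qed
    ultimately have "openin (top_of_set C) {x}" by (metis openin_open)
    moreover have "closedin (top_of_set C) {x}"
      using x by (intro closed_subset) (auto simp: C_def)
    ultimately show "openin (top_of_set C) {x} \<and> closedin (top_of_set C) {x}" ..
  qed
  show ?thesis using ef metrizable_infinite_dimensional_quotient by blast
qed

end
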